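(* Let $A=K[a_1,\ldots,a_n]$ be a weighted $\mathbb{N}$-graded solvable polynomial algebra with respect to a positive-degree function $d(\ )$, with admissible system $(\mathscr{B},\prec)$, let $L=\oplus_{i=1}^sAe_i$ be an $\mathbb{N}$-graded free left $A$-module with $d_{\rm gr}(e_i)=b_i$, and let $\prec_e$ be a left monomial ordering on $\{a^{\alpha}e_i\}$. Given a finite set of nonzero homogeneous elements $U=\{\xi_1,\ldots,\xi_m\}\subset L$ with $d_{\rm gr}(\xi_1)\le d_{\rm gr}(\xi_2)\le\cdots\le d_{\rm gr}(\xi_m)$, and a positive integer $n_0\ge d_{\rm gr}(\xi_1)$, the following algorithm computes an $n_0$-truncated left Gröbner basis $\mathcal{G}=\{g_1,\ldots,g_t\}$ for the graded submodule $N=\sum_{i=1}^mA\xi_i$ such that $d_{\rm gr}(g_1)\le d_{\rm gr}(g_2)\le\cdots\le d_{\rm gr}(g_t)$. Algorithm. Initialize $\mathcal{S}_{\le n_0}:=\emptyset$, $W:=U$, $\mathcal{G}:=\emptyset$, $t':=0$. Execute the following loop until $\mathcal{S}_{\le n_0}=\emptyset$ (the condition being tested at the end of each pass through the loop): Let $\nu:=\min\{d_{\rm gr}(\xi_i),\ d_{\rm gr}(S_{\ell}(g_i,g_j))\mid \xi_i\in W,\ S_{\ell}(g_i,g_j)\in\mathcal{S}_{\le n_0}\}$. Put $\mathcal{S}_\nu:=\{S_{\ell}(g_i,g_j)\in\mathcal{S}_{\le n_0}\mid d_{\rm gr}(S_{\ell}(g_i,g_j))=\nu\}$, $W_\nu:=\{\xi_j\in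 W\mid d_{\rm gr}(\xi_j)=\nu\}$, $\mathcal{S}_{\le n_0}:=\mathcal{S}_{\le n_0}-\mathcal{S}_\nu$, $W:=W-W_\nu$. (a) While $\mathcal{S}_\nu\ne\emptyset$: choose any $S_{\ell}(g_i,g_j)\in\mathcal{S}_\nu$, remove it from $\mathcal{S}_\nu$, and let $\eta=\overline{S_{\ell}(g_i,g_j)}^{\mathcal{G}}$. If $\eta\ne0$ with $\mathbf{LM}(\eta)=a^{\rho}e_k$, set $t':=t'+1$, $g_{t'}:=\eta$, $\mathcal{S}_{\le n_0}:=\mathcal{S}_{\le n_0}\cup\{S_{\ell}(g_i,g_{t'})\mid g_i\in\mathcal{G},\ 1\le i<t',\ \mathbf{LM}(g_i)=a^{\tau}e_k\text{ for some }\tau,\ d_{\rm gr}(S_{\ell}(g_i,g_{t'}))\le n_0\}$, $\mathcal{G}:=\mathcal{G}\cup\{g_{t'}\}$. (b) Then, while $W_\nu\ne\emptyset$: choose any $\xi_j\in W_\nu$, remove it from $W_\nu$, and let $\eta=\overline{\xi_j}^{\mathcal{G}}$. If $\eta\ne0$ with $\mathbf{LM}(\eta)=a^{\rho}e_k$, set $t':=t'+1$, $g_{t'}:=\eta$, $\mathcal{S}_{\le n_0}:=\mathcal{S}_{\le n_0}\cup\{S_{\ell}(g_i,g_{t'})\mid g_i\in\mathcal{G},\ 1\le i<t',\ \mathbf{LM}(g_i)=a^{\tau}e_k\text{ for some }\tau,\ d_{\rm gr}(S_{\ell}(g_i,g_{t'}))\le n_0\}$, $\mathcal{G}:=\ma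thcal{G}\cup\{g_{t'}\}$.
   Context: $K$ is a field, $K^*=K\setminus\{0\}$, $\mathbb{N}$ is the set of nonnegative integers; algebras are associative unital $K$-algebras; modules are left unitary modules. Solvable polynomial algebra. $A=K[a_1,\ldots,a_n]$ is a $K$-algebra generated by a minimal generating set $\{a_1,\ldots,a_n\}$ (not necessarily commuting) such that $\mathscr{B}=\{a^{\alpha}=a_1^{\alpha_1}\cdots a_n^{\alpha_n}\mid\alpha\in\mathbb{N}^n\}$ is a $K$-basis of $A$; elements of $\mathscr{B}$ are monomials. For a total ordering $\prec$ on $\mathscr{B}$ and $0\ne f\in A$, $\mathbf{LM}(f)$ is the largest monomial occurring in $f$, $\mathbf{LC}(f)$ its coefficient, $\mathbf{LT}(f)=\mathbf{LC}(f)\mathbf{LM}(f)$. $\prec$ is a monomial ordering if: (1) it is a well-ordering; (2) if $a^{\alpha}\prec a^{\beta}$ and $\mathbf{LM}(a^{\gamma}a^{\alpha}a^{\eta}),\mathbf{LM}(a^{\gamma}a^{\beta}a^{\eta})\notin K$ then $\mathbf{LM}(a^{\gamma}a^{\alpha}a^{\eta})\prec\mathbf{LM}(a^{\gamma}a^{\beta}a^{\eta})$; (3) if $a^{\beta}\ne a^{\gamma}$ and $a^{\gamma}=\mathbf{LM}(a^{\alpha}a^{\beta}a^{\eta})$ then $a^{\beta}\prec a^{\gamma}$. Then $(\mathscr{B},\prec)$ is an admissible system. $A$ is a solvable polynomial algebra if moreover for all $\alpha,\beta$: $a^{\alpha}a^{\beta}=\lambda_{\alpha,\beta}a^{\alpha+\beta}+f_{\alpha,\beta}$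 with $\lambda_{\alpha,\beta}\in K^*$ and $f_{\alpha,\beta}=0$ or $\mathbf{LM}(f_{\alpha,\beta})\prec a^{\alpha+\beta}$. Grading. A positive-degree function $d(\ )$ is given by integers $d(a_i)=m_i>0$, $d(a^{\alpha})=\sum m_i\alpha_i$. Put $A_p=K\text{-span}\{a^{\alpha}\mid d(a^{\alpha})=p\}$; $A$ is weighted $\mathbb{N}$-graded with respect to $d(\ )$ if $A_pA_q\subseteq A_{p+q}$ for all $p,q$. For $L=\oplus_iAe_i$ with arbitrarily chosen $b_i\in\mathbb{N}$, the grading is $L=\oplus_qL_q$, $L_q=K\text{-span}\{a^{\alpha}e_i\mid d(a^{\alpha})+b_i=q\}$, so $d_{\rm gr}(e_i)=b_i$; $d_{\rm gr}$ denotes the degree of a nonzero homogeneous element. A graded submodule is one generated by homogeneous elements. Orderings and division in $L$. A left monomial ordering $\prec_e$ is a total ordering on $\{a^{\alpha}e_i\}$ such that (1) $a^{\alpha}e_i\prec_ea^{\beta}e_j$ implies $\mathbf{LM}(a^{\gamma}a^{\alpha}e_i)\prec_e\mathbf{LM}(a^{\gamma}a^{\beta}e_j)$ for all $a^{\gamma}\in\mathscr{B}$; (2) $a^{\alpha}\prec a^{\beta}$ implies $a^{\alpha}e_i\prec_ea^{\beta}e_i$. $\mathbf{LM},\mathbf{LC},\mathbf{LT}$ for elements of $L$ are taken with respect to $\prec_e$. $a^{\alpha}e_i\mid a^{\beta}e_j$ means $i=j$ and $a^{\beta}e_j=\mathbf{LM}(a^{\gamma}a^{\alpha}e_i)$ for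 some $a^{\gamma}\in\mathscr{B}$ (equivalently $i=j$ and $\alpha_k\le\beta_k$ for all $k$). Division of $\xi\in L$ by a finite set $P\subset L\setminus\{0\}$: if $\mathbf{LM}(p)\mid\mathbf{LM}(\xi)$ for some $p\in P$, with $\mathbf{LM}(\xi)=\mathbf{LM}(a^{\gamma}p)$, replace $\xi$ by $\xi-\frac{\mathbf{LC}(\xi)}{\mathbf{LC}(a^{\gamma}p)}a^{\gamma}p$; otherwise move $\mathbf{LT}(\xi)$ to the remainder and replace $\xi$ by $\xi-\mathbf{LT}(\xi)$; continue until $0$ is reached. The resulting remainder is denoted $\overline{\xi}^{P}$ (with $\overline{\xi}^{\emptyset}=\xi$). For $\mathbf{LM}(\xi_i)=a^{\alpha(i)}e_t$, $\mathbf{LM}(\xi_j)=a^{\alpha(j)}e_t$ and $\gamma$ the componentwise maximum of $\alpha(i),\alpha(j)$, the left S-polynomial is $S_{\ell}(\xi_i,\xi_j)=\frac{1}{\mathbf{LC}(a^{\gamma-\alpha(i)}\xi_i)}a^{\gamma-\alpha(i)}\xi_i-\frac{1}{\mathbf{LC}(a^{\gamma-\alpha(j)}\xi_j)}a^{\gamma-\alpha(j)}\xi_j$; for homogeneous elements its degree is $d_{\rm gr}(S_{\ell}(\xi_i,\xi_j))=d(a^{\gamma})+b_t$. Truncated Gröbner bases. Let $G=\{g_1,\ldots,g_t\}$ be a subset of homogeneous elements of $L$, $N=\sum_{i=1}^tAg_i$ the graded submodule generated by $G$, and for $\nu\in\mathbb{N}$ let $G_{\le\nu}=\{g_j\in G\mid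 d_{\rm gr}(g_j)\le\nu\}$. If for each nonzero homogeneous element $\xi\in N$ with $d_{\rm gr}(\xi)\le\nu$ there is some $g_i\in G_{\le\nu}$ such that $\mathbf{LM}(g_i)\mid\mathbf{LM}(\xi)$ with respect to $\prec_e$, then $G_{\le\nu}$ is called a $\nu$-truncated left Gröbner basis of $N$ (with respect to $\prec_e$).
   Formalization: The loop stops only when S_{≤n0} is empty and no element of W of degree ≤ n0 remains; as printed (testing S_{≤n0} only) the claim fails, e.g. for U={x,y^2} in K[x,y] with n0=2, where the output would be {x}. *)

theory Defs
  imports "HOL-Analysis.Finite_Cartesian_Product"
begin

locale assoc_algebra = vector_space scale
  for scale :: "'k::field \<Rightarrow> 'a::ring_1 \<Rightarrow> 'a" +
  assumes scale_mult_left: "scale c x * y = scale c (x * y)"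
    and scale_mult_right: "x * scale c y = scale c (x * y)"
begin

definition base_field :: "'a set" where
  "base_field = range (\<lambda>c. scale c 1)"

definition generated_subalgebra :: "'a set \<Rightarrow> 'a set" where
  "generated_subalgebra X = span {prod_list ys | ys. set ys \<subseteq> X}"

end

text \<open>The generators are indexed by a finite linearly ordered type \<open>'n\<close>, whose order fixes the
  order of the factors of a monomial. The monomial \<open>mon a \<alpha>\<close> is identified with its exponent
  \<open>\<alpha>\<close>, so orderings of the monomials are relations on exponents.\<close>

type_synonym 'n expo = "'n \<Rightarrow> nat"

definition mon :: "('n::{finite,linorder} \<Rightarrow> 'a::monoid_mult) \<Rightarrow> 'n expo \<Rightarrow> 'a" where
  "mon a \<alpha> = prod_list (map (\<lambda>i. a i ^ \<alpha> i) (sorted_list_of_set UNIV))"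

definition leading_index :: "('m \<Rightarrow> 'm \<Rightarrow> bool) \<Rightarrow> ('m \<Rightarrow> 'k::zero) \<Rightarrow> 'm" where
  "leading_index prec c = (THE \<mu>. c \<mu> \<noteq> 0 \<and> (\<forall>\<nu>. c \<nu> \<noteq> 0 \<longrightarrow> \<nu> = \<mu> \<or> prec \<nu> \<mu>))"

locale monomial_basis_algebra = assoc_algebra scale
  for scale :: "'k::field \<Rightarrow> 'a::ring_1 \<Rightarrow> 'a" +
  fixes a :: "'n::{finite,linorder} \<Rightarrow> 'a"
  assumes generators: "generated_subalgebra (range a) = UNIV"
    and generators_minimal: "\<And>Y. Y \<subset> range a \<Longrightarrow> generated_subalgebra Y \<noteq> UNIV"
    and mon_inj: "inj (mon a)"
    and mon_independent: "independent (range (mon a))"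
    and mon_span: "span (range (mon a)) = UNIV"
begin

definition coeff :: "'a \<Rightarrow> 'n expo \<Rightarrow> 'k" where
  "coeff f \<alpha> = representation (range (mon a)) f (mon a \<alpha>)"

definition LM :: "('n expo \<Rightarrow> 'n expo \<Rightarrow> bool) \<Rightarrow> 'a \<Rightarrow> 'n expo" where
  "LM prec f = leading_index prec (coeff f)"

text \<open>The guards \<open>\<noteq> 0\<close> only make explicit that \<open>LM\<close> is meaningful for nonzero elements. They
  are automatic in a solvable polynomial algebra.\<close>

definition monomial_ordering :: "('n expo \<Rightarrow> 'n expo \<Rightarrow> bool) \<Rightarrow> bool" where
  "monomial_ordering prec \<longleftrightarrow>
     irreflp prec \<and> transp prec \<and> totalp prec \<and> wfp prec \<and>
     (\<forall>\<alpha> \<beta> \<gamma> \<eta>.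
        prec \<alpha> \<beta> \<and>
        mon a \<gamma> * mon a \<alpha> * mon a \<eta> \<noteq> 0 \<and> mon a \<gamma> * mon a \<beta> * mon a \<eta> \<noteq> 0 \<and>
        mon a (LM prec (mon a \<gamma> * mon a \<alpha> * mon a \<eta>)) \<notin> base_field \<and>
        mon a (LM prec (mon a \<gamma> * mon a \<beta> * mon a \<eta>)) \<notin> base_field \<longrightarrow>
        prec (LM prec (mon a \<gamma> * mon a \<alpha> * mon a \<eta>)) (LM prec (mon a \<gamma> * mon a \<beta> * mon a \<eta>))) \<and>
     (\<forall>\<alpha> \<beta> \<gamma> \<eta>.
        \<beta> \<noteq> \<gamma> \<and> mon a \<alpha> * mon a \<beta> * mon a \<eta> \<noteq> 0 \<and>
        \<gamma> = LM prec (mon a \<alpha> * mon a \<beta> * mon a \<eta>) \<longrightarrow> prec \<beta> \<gamma>)"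

end

locale solvable_polynomial_algebra = monomial_basis_algebra scale a
  for scale :: "'k::field \<Rightarrow> 'a::ring_1 \<Rightarrow> 'a" and a :: "'n::{finite,linorder} \<Rightarrow> 'a" +
  fixes prec :: "'n expo \<Rightarrow> 'n expo \<Rightarrow> bool"
  assumes ordering: "monomial_ordering prec"
    and solvable: "\<And>\<alpha> \<beta>. \<exists>l f. l \<noteq> 0 \<and>
           mon a \<alpha> * mon a \<beta> = scale l (mon a (\<lambda>i. \<alpha> i + \<beta> i)) + f \<and>
           (f = 0 \<or> prec (LM prec f) (\<lambda>i. \<alpha> i + \<beta> i))"

definition wdeg :: "('n::finite \<Rightarrow> nat) \<Rightarrow> 'n expo \<Rightarrow> nat" where
  "wdeg m \<alpha> = (\<Sum>i\<in>UNIV. m i * \<alpha> i)"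

locale graded_solvable_polynomial_algebra = solvable_polynomial_algebra scale a prec
  for scale :: "'k::field \<Rightarrow> 'a::ring_1 \<Rightarrow> 'a" and a :: "'n::{finite,linorder} \<Rightarrow> 'a"
    and prec :: "'n expo \<Rightarrow> 'n expo \<Rightarrow> bool" +
  fixes m :: "'n \<Rightarrow> nat"
  assumes weights_pos: "\<And>i. m i > 0"
    and graded: "\<And>p q x y. x \<in> span {mon a \<alpha> | \<alpha>. wdeg m \<alpha> = p} \<Longrightarrow>
           y \<in> span {mon a \<alpha> | \<alpha>. wdeg m \<alpha> = q} \<Longrightarrow>
           x * y \<in> span {mon a \<alpha> | \<alpha>. wdeg m \<alpha> = p + q}"

text \<open>The free left module with basis \<open>e\<^sub>i\<close>, \<open>i :: 's\<close>, is \<open>'a ^ 's\<close> with \<open>e\<^sub>i = axis i 1\<close>; the left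
  action of the algebra is the componentwise left multiplication \<open>(*s)\<close>. The monomial
  \<open>a\<^sup>\<alpha> e\<^sub>i\<close> is identified with the pair \<open>(\<alpha>, i)\<close>.\<close>

type_synonym ('n, 's) lmon = "'n expo \<times> 's"

definition left_submodule_generated :: "('a::ring_1 ^ 's::finite) set \<Rightarrow> ('a ^ 's) set" where
  "left_submodule_generated G = {\<Sum>g\<in>F. c g *s g | F c. finite F \<and> F \<subseteq> G}"

context monomial_basis_algebra
begin

definition emon :: "('n, 's::finite) lmon \<Rightarrow> 'a ^ 's" where
  "emon \<mu> = mon a (fst \<mu>) *s axis (snd \<mu>) 1"

definition scaleL :: "'k \<Rightarrow> 'a ^ 's::finite \<Rightarrow> 'a ^ 's" where
  "scaleL c v = (\<chi> i. scale c (v $ i))"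

definition coeffL :: "'a ^ 's::finite \<Rightarrow> ('n, 's) lmon \<Rightarrow> 'k" where
  "coeffL v \<mu> = coeff (v $ snd \<mu>) (fst \<mu>)"

definition LML :: "(('n, 's::finite) lmon \<Rightarrow> ('n, 's) lmon \<Rightarrow> bool) \<Rightarrow> 'a ^ 's \<Rightarrow> ('n, 's) lmon" where
  "LML prec v = leading_index prec (coeffL v)"

definition LCL :: "(('n, 's::finite) lmon \<Rightarrow> ('n, 's) lmon \<Rightarrow> bool) \<Rightarrow> 'a ^ 's \<Rightarrow> 'k" where
  "LCL prec v = coeffL v (LML prec v)"

definition LTL :: "(('n, 's::finite) lmon \<Rightarrow> ('n, 's) lmon \<Rightarrow> bool) \<Rightarrow> 'a ^ 's \<Rightarrow> 'a ^ 's" where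
  "LTL prec v = scaleL (LCL prec v) (emon (LML prec v))"

definition left_monomial_ordering ::
    "('n expo \<Rightarrow> 'n expo \<Rightarrow> bool) \<Rightarrow> (('n, 's::finite) lmon \<Rightarrow> ('n, 's) lmon \<Rightarrow> bool) \<Rightarrow> bool" where
  "left_monomial_ordering prec prece \<longleftrightarrow>
     irreflp prece \<and> transp prece \<and> totalp prece \<and>
     (\<forall>\<mu> \<nu> \<gamma>. prece \<mu> \<nu> \<longrightarrow>
        prece (LML prece (mon a \<gamma> *s emon \<mu>)) (LML prece (mon a \<gamma> *s emon \<nu>))) \<and>
     (\<forall>\<alpha> \<beta> i. prec \<alpha> \<beta> \<longrightarrow> prece (\<alpha>, i) (\<beta>, i))"

end

text \<open>Program points of the algorithm. The sets of S-polynomials are represented by sets of index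
  pairs \<open>(i, j)\<close>, \<open>i < j\<close>, into the list of the elements found so far (indices start at 0): the
  degree of an S-polynomial depends on the pair and is defined even if the S-polynomial vanishes.
  \<open>Head S W G\<close> is the beginning of a pass, \<open>Body S W S' W' G\<close> a point inside the pass for some
  degree \<open>\<nu>\<close>, with \<open>S'\<close> and \<open>W'\<close> what is left of \<open>\<S>\<^sub>\<nu>\<close> and \<open>W\<^sub>\<nu>\<close>.\<close>

datatype 'v state =
    Head "(nat \<times> nat) set" "'v set" "'v list"
  | Body "(nat \<times> nat) set" "'v set" "(nat \<times> nat) set" "'v set" "'v list"
  | Done "'v list"

locale graded_free_module = graded_solvable_polynomial_algebra scale a prec m
  for scale :: "'k::field \<Rightarrow> 'a::ring_1 \<Rightarrow> 'a" and a :: "'n::{finite,linorder} \<Rightarrow> 'a"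
    and prec :: "'n expo \<Rightarrow> 'n expo \<Rightarrow> bool" and m :: "'n \<Rightarrow> nat" +
  fixes b :: "'s::finite \<Rightarrow> nat"
    and prece :: "('n, 's) lmon \<Rightarrow> ('n, 's) lmon \<Rightarrow> bool"
  assumes left_ordering: "left_monomial_ordering prec prece"
begin

definition hom_part :: "nat \<Rightarrow> ('a ^ 's) set" where
  "hom_part q = module.span scaleL {emon (\<alpha>, i) | \<alpha> i. wdeg m \<alpha> + b i = q}"

definition homogeneous :: "'a ^ 's \<Rightarrow> bool" where
  "homogeneous v \<longleftrightarrow> (\<exists>q. v \<in> hom_part q)"

definition dgr :: "'a ^ 's \<Rightarrow> nat" where
  "dgr v = (THE q. v \<in> hom_part q)"

abbreviation lm :: "'a ^ 's \<Rightarrow> ('n, 's) lmon" where "lm \<equiv> LML prece"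
abbreviation lc :: "'a ^ 's \<Rightarrow> 'k" where "lc \<equiv> LCL prece"
abbreviation lt :: "'a ^ 's \<Rightarrow> 'a ^ 's" where "lt \<equiv> LTL prece"

definition mon_dvd :: "('n, 's) lmon \<Rightarrow> ('n, 's) lmon \<Rightarrow> bool" where
  "mon_dvd \<mu> \<nu> \<longleftrightarrow> snd \<mu> = snd \<nu> \<and> (\<exists>\<gamma>. \<nu> = lm (mon a \<gamma> *s emon \<mu>))"

text \<open>Division is nondeterministic: any divisor with suitable leading monomial may be used. The
  second component of a state collects the remainder. \<open>remainder P \<xi> \<eta>\<close> says that \<open>\<eta>\<close> is the result of
  some division of \<open>\<xi>\<close> by \<open>P\<close>.\<close>

inductive div_step :: "('a ^ 's) set \<Rightarrow> ('a ^ 's) \<times> ('a ^ 's) \<Rightarrow> ('a ^ 's) \<times> ('a ^ 's) \<Rightarrow> bool"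
  for P where
  reduce: "\<lbrakk>\<xi> \<noteq> 0; p \<in> P; mon_dvd (lm p) (lm \<xi>); lm \<xi> = lm (mon a \<gamma> *s p)\<rbrakk> \<Longrightarrow>
     div_step P (\<xi>, r) (\<xi> - scaleL (lc \<xi> / lc (mon a \<gamma> *s p)) (mon a \<gamma> *s p), r)"
| move: "\<lbrakk>\<xi> \<noteq> 0; \<forall>p\<in>P. \<not> mon_dvd (lm p) (lm \<xi>)\<rbrakk> \<Longrightarrow>
     div_step P (\<xi>, r) (\<xi> - lt \<xi>, r + lt \<xi>)"

definition remainder :: "('a ^ 's) set \<Rightarrow> 'a ^ 's \<Rightarrow> 'a ^ 's \<Rightarrow> bool" where
  "remainder P \<xi> \<eta> \<longleftrightarrow> (div_step P)\<^sup>*\<^sup>* (\<xi>, 0) (0, \<eta>)"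

definition lcm_expo :: "'a ^ 's \<Rightarrow> 'a ^ 's \<Rightarrow> 'n expo" where
  "lcm_expo g h = (\<lambda>k. max (fst (lm g) k) (fst (lm h) k))"

definition lcm_multiple :: "'a ^ 's \<Rightarrow> 'a ^ 's \<Rightarrow> 'a ^ 's" where
  "lcm_multiple g h = mon a (\<lambda>k. lcm_expo g h k - fst (lm g) k) *s g"

text \<open>\<open>spoly g h\<close> and \<open>spoly_deg g h\<close> are used only if \<open>snd (lm g) = snd (lm h)\<close>.\<close>

definition spoly :: "'a ^ 's \<Rightarrow> 'a ^ 's \<Rightarrow> 'a ^ 's" where
  "spoly g h = scaleL (1 / lc (lcm_multiple g h)) (lcm_multiple g h)
             - scaleL (1 / lc (lcm_multiple h g)) (lcm_multiple h g)"

definition spoly_deg :: "'a ^ 's \<Rightarrow> 'a ^ 's \<Rightarrow> nat" where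
  "spoly_deg g h = wdeg m (lcm_expo g h) + b (snd (lm g))"

text \<open>\<open>H\<close> is a \<open>\<nu>\<close>-truncated left Groebner basis of \<open>N\<close> if it is \<open>G\<^bsub>\<le>\<nu>\<^esub>\<close> for a finite set \<open>G\<close> of
  nonzero homogeneous generators of \<open>N\<close> with the required property; \<open>H\<close> itself need not generate \<open>N\<close>.\<close>

definition truncated_left_GB :: "nat \<Rightarrow> ('a ^ 's) set \<Rightarrow> ('a ^ 's) set \<Rightarrow> bool" where
  "truncated_left_GB \<nu> H N \<longleftrightarrow>
     (\<exists>G. finite G \<and> (\<forall>g\<in>G. g \<noteq> 0 \<and> homogeneous g) \<and>
          N = left_submodule_generated G \<and> H = {g \<in> G. dgr g \<le> \<nu>} \<and>
          (\<forall>\<xi>\<in>N. \<xi> \<noteq> 0 \<and> homogeneous \<xi> \<and> dgr \<xi> \<le> \<nu> \<longrightarrow> (\<exists>g\<in>H. mon_dvd (lm g) (lm \<xi>))))"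

definition pair_deg :: "('a ^ 's) list \<Rightarrow> nat \<times> nat \<Rightarrow> nat" where
  "pair_deg G = (\<lambda>(i, j). spoly_deg (G ! i) (G ! j))"

definition new_pairs :: "nat \<Rightarrow> ('a ^ 's) list \<Rightarrow> 'a ^ 's \<Rightarrow> (nat \<times> nat) set" where
  "new_pairs n0 G \<eta> = {(i, length G) | i. i < length G \<and>
     snd (lm (G ! i)) = snd (lm \<eta>) \<and> spoly_deg (G ! i) \<eta> \<le> n0}"

text \<open>The loop is left when no S-polynomial of degree \<open>\<le> n0\<close> and no input element of degree
  \<open>\<le> n0\<close> is pending. Testing only for pending S-polynomials would be incorrect: for
  \<open>U = {x, y\<^sup>2}\<close> in \<open>K[x, y]\<close>, \<open>n0 = 2\<close>, the loop would stop after its first pass with output \<open>{x}\<close>.\<close>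

inductive step :: "nat \<Rightarrow> ('a ^ 's) state \<Rightarrow> ('a ^ 's) state \<Rightarrow> bool"
  for n0 where
  begin_pass: "\<lbrakk>\<nu> = Min (dgr ` W \<union> pair_deg G ` S);
     S' = {p \<in> S. pair_deg G p = \<nu>}; W' = {\<xi> \<in> W. dgr \<xi> = \<nu>}\<rbrakk> \<Longrightarrow>
     step n0 (Head S W G) (Body (S - S') (W - W') S' W' G)"
| spoly_zero: "\<lbrakk>(i, j) \<in> S'; remainder (set G) (spoly (G ! i) (G ! j)) 0\<rbrakk> \<Longrightarrow>
     step n0 (Body S W S' W' G) (Body S W (S' - {(i, j)}) W' G)"
| spoly_nonzero: "\<lbrakk>(i, j) \<in> S'; remainder (set G) (spoly (G ! i) (G ! j)) \<eta>; \<eta> \<noteq> 0\<rbrakk> \<Longrightarrow>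
     step n0 (Body S W S' W' G)
       (Body (S \<union> new_pairs n0 G \<eta>) W (S' - {(i, j)}) W' (G @ [\<eta>]))"
| input_zero: "\<lbrakk>\<xi> \<in> W'; remainder (set G) \<xi> 0\<rbrakk> \<Longrightarrow>
     step n0 (Body S W {} W' G) (Body S W {} (W' - {\<xi>}) G)"
| input_nonzero: "\<lbrakk>\<xi> \<in> W'; remainder (set G) \<xi> \<eta>; \<eta> \<noteq> 0\<rbrakk> \<Longrightarrow>
     step n0 (Body S W {} W' G)
       (Body (S \<union> new_pairs n0 G \<eta>) W {} (W' - {\<xi>}) (G @ [\<eta>]))"
| continue: "S \<noteq> {} \<or> (\<exists>\<xi>\<in>W. dgr \<xi> \<le> n0) \<Longrightarrow> step n0 (Body S W {} {} G) (Head S W G)"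
| stop: "\<lbrakk>S = {}; \<forall>\<xi>\<in>W. n0 < dgr \<xi>\<rbrakk> \<Longrightarrow> step n0 (Body S W {} {} G) (Done G)"

end

end

theory Submission
  imports Defs
begin

text \<open>The solvability relations give \<open>lm (a\<^sup>\<gamma> v) = \<gamma> + lm v\<close>, and the module ordering is a well-ordering
  because it restricts to the ordering of the algebra on each of the finitely many components. Hence
  division terminates. A new element of the basis has a leading monomial different from the earlier
  ones and degree at most \<open>n0\<close>; since the weights are positive there are only finitely many such
  monomials, so the algorithm terminates.

  At the end every S-polynomial of degree at most \<open>n0\<close> is a combination of multiples \<open>a\<^sup>\<epsilon> g\<close> with
  leading monomial below the lcm. Consequently two multiples \<open>a\<^sup>\<gamma> g\<close>, \<open>a\<^sup>\<delta> h\<close> with the same leading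
  monomial \<open>\<mu>\<close> of degree at most \<open>n0\<close> are proportional modulo multiples with leading monomial below
  \<open>\<mu>\<close>. By well-founded induction, choosing a single multiple for each \<open>\<mu>\<close> spans all of them over the
  base field, and the leading monomial of a linear combination of elements with distinct leading
  monomials is one of these. Homogeneous elements of the submodule of degree at most \<open>n0\<close> involve no
  generators of higher degree, so the pending inputs of degree above \<open>n0\<close> can be ignored.\<close>

section \<open>Coefficients\<close>

lemma sum_mult_delta:
  fixes c :: "'i \<Rightarrow> 'k::semiring_1"
  assumes "finite F"
  shows "(\<Sum>i\<in>F. c i * (if j = i then 1 else 0)) = (if j \<in> F then c j else 0)"
proof -
  have "(\<Sum>i\<in>F. c i * (if j = i then 1 else 0)) = (\<Sum>i\<in>F. if j = i then c i else 0)"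
    by (rule sum.cong) auto
  then show ?thesis using assms by simp
qed

lemma vec_mult_sum: "x *s (\<Sum>i\<in>F. f i) = (\<Sum>i\<in>F. x *s (f i :: 'a::ring_1 ^ 's))"
  by (simp add: vec_eq_iff sum_distrib_left)

lemma vec_sum_mult: "(\<Sum>i\<in>F. f i) *s v = (\<Sum>i\<in>F. f i *s (v :: 'a::ring_1 ^ 's))"
  by (simp add: vec_eq_iff sum_distrib_right)

section \<open>Leading indices of finitely supported functions\<close>

lemma leading_index_eqI:
  assumes "irreflp R" "transp R" "c \<mu> \<noteq> 0" "\<And>\<nu>. c \<nu> \<noteq> 0 \<Longrightarrow> \<nu> = \<mu> \<or> R \<nu> \<mu>"
  shows "leading_index R c = \<mu>"
  unfolding leading_index_def
proof (rule the_equality)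
  show "c \<mu> \<noteq> 0 \<and> (\<forall>\<nu>. c \<nu> \<noteq> 0 \<longrightarrow> \<nu> = \<mu> \<or> R \<nu> \<mu>)" using assms by auto
  fix \<mu>' assume "c \<mu>' \<noteq> 0 \<and> (\<forall>\<nu>. c \<nu> \<noteq> 0 \<longrightarrow> \<nu> = \<mu>' \<or> R \<nu> \<mu>')"
  then show "\<mu>' = \<mu>"
    using assms(3) assms(4)[of \<mu>'] transpD[OF assms(2), of \<mu> \<mu>' \<mu>] irreflpD[OF assms(1), of \<mu>] by blast
qed

text \<open>A nonempty finite support has a maximal element for \<open>R\<close>, and totality makes
  it the greatest one.\<close>

lemma leading_index_exists:
  assumes "irreflp R" "transp R" "totalp R" "finite {\<mu>. c \<mu> \<noteq> 0}" "c \<kappa> \<noteq> 0"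
  shows "c (leading_index R c) \<noteq> 0 \<and>
    (\<forall>\<nu>. c \<nu> \<noteq> 0 \<longrightarrow> \<nu> = leading_index R c \<or> R \<nu> (leading_index R c))"
proof -
  have "asymp_on {\<mu>. c \<mu> \<noteq> 0} R"
  proof (rule asymp_onI)
    show "\<not> R y x" if "R x y" for x y
      using that assms(1) transpD[OF assms(2), of x y x] irreflpD[OF assms(1), of x] by blast
  qed
  moreover have "transp_on {\<mu>. c \<mu> \<noteq> 0} R"
    using assms(2) by (rule transp_on_subset) simp
  ultimately obtain \<mu> where "c \<mu> \<noteq> 0" "\<forall>x. c x \<noteq> 0 \<longrightarrow> x \<noteq> \<mu> \<longrightarrow> \<not> R \<mu> x"
    using Finite_Set.bex_max_element[of "{\<mu>. c \<mu> \<noteq> 0}" R] assms(4,5) by auto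
  then have *: "c \<mu> \<noteq> 0" "\<And>\<nu>. c \<nu> \<noteq> 0 \<Longrightarrow> \<nu> = \<mu> \<or> R \<nu> \<mu>"
    using assms(3) by (auto dest: totalpD)
  with leading_index_eqI[OF assms(1,2), of c \<mu>] show ?thesis by metis
qed

context monomial_basis_algebra
begin

section \<open>Coefficients with respect to the monomial basis of the algebra\<close>

lemma coeff_add: "coeff (x + y) \<alpha> = coeff x \<alpha> + coeff y \<alpha>"
  unfolding coeff_def using representation_add[OF mon_independent, of y x] mon_span by simp

lemma coeff_diff: "coeff (x - y) \<alpha> = coeff x \<alpha> - coeff y \<alpha>"
  unfolding coeff_def using representation_diff[OF mon_independent, of y x] mon_span by simp

lemma coeff_scale: "coeff (scale c x) \<alpha> = c * coeff x \<alpha>"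
  unfolding coeff_def using representation_scale[OF mon_independent, of x c] mon_span by simp

lemma coeff_zero: "coeff 0 \<alpha> = 0"
  unfolding coeff_def by (simp add: representation_zero)

lemma coeff_mon: "coeff (mon a \<alpha>) \<beta> = (if \<beta> = \<alpha> then 1 else 0)"
  unfolding coeff_def using representation_basis[OF mon_independent, of "mon a \<alpha>"] mon_inj
  by (auto simp: inj_def)

lemma finite_coeff: "finite {\<alpha>. coeff f \<alpha> \<noteq> 0}"
proof -
  have "{\<alpha>. coeff f \<alpha> \<noteq> 0} = mon a -` {v. representation (range (mon a)) f v \<noteq> 0}"
    by (auto simp: coeff_def)
  then show ?thesis using finite_vimageI[OF finite_representation mon_inj] by metis
qed

lemma coeff_sum: "coeff (\<Sum>x\<in>F. f x) \<alpha> = (\<Sum>x\<in>F. coeff (f x) \<alpha>)"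
  by (induction F rule: infinite_finite_induct) (auto simp: coeff_add coeff_zero)

text \<open>The representation vanishes off the monomials, so the coefficients determine it, and an
  element is the sum given by its representation.\<close>

lemma coeff_eqI:
  assumes "\<And>\<alpha>. coeff x \<alpha> = coeff y \<alpha>"
  shows "x = y"
proof -
  have *: "representation (range (mon a)) x = representation (range (mon a)) y"
  proof
    fix v
    show "representation (range (mon a)) x v = representation (range (mon a)) y v"
    proof (cases "v \<in> range (mon a)")
      case True
      then show ?thesis using assms by (auto simp: coeff_def)
    next
      case False
      then have "representation (range (mon a)) z v = 0" for z
        using representation_ne_zero by blast
      then show ?thesis by simp
    qed
  qed
  have **: "(\<Sum>v | representation (range (mon a)) z v \<noteq> 0.
      scale (representation (range (mon a)) z v) v) = z" for z
    using sum_nonzero_representation_eq[OF mon_independent] mon_span by simp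
  show ?thesis using **[of x] **[of y] unfolding * by (rule trans[OF sym])
qed

lemma coeff_expand: "f = (\<Sum>\<alpha> | coeff f \<alpha> \<noteq> 0. scale (coeff f \<alpha>) (mon a \<alpha>))"
proof (rule coeff_eqI)
  fix \<beta>
  show "coeff f \<beta> = coeff (\<Sum>\<alpha> | coeff f \<alpha> \<noteq> 0. scale (coeff f \<alpha>) (mon a \<alpha>)) \<beta>"
    by (simp add: coeff_sum coeff_scale coeff_mon sum_mult_delta finite_coeff)
qed

lemma coeff_span:
  assumes "f \<in> span {mon a \<alpha> | \<alpha>. Q \<alpha>}" "coeff f \<beta> \<noteq> 0"
  shows "Q \<beta>"
proof -
  have "\<forall>\<beta>. coeff f \<beta> \<noteq> 0 \<longrightarrow> Q \<beta>"
    using assms(1)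
  proof (induction rule: span_induct_alt)
    case base
    show ?case by (simp add: coeff_zero)
  next
    case (step c x y)
    then show ?case by (auto simp: coeff_add coeff_scale coeff_mon split: if_splits)
  qed
  with assms(2) show ?thesis by blast
qed

section \<open>Coefficients and scalar action in the free module\<close>

lemma coeffL_add: "coeffL (x + y) \<mu> = coeffL x \<mu> + coeffL y \<mu>"
  by (simp add: coeffL_def coeff_add)

lemma coeffL_diff: "coeffL (x - y) \<mu> = coeffL x \<mu> - coeffL y \<mu>"
  by (simp add: coeffL_def coeff_diff)

lemma coeffL_scaleL: "coeffL (scaleL c x) \<mu> = c * coeffL x \<mu>"
  by (simp add: coeffL_def scaleL_def coeff_scale)

lemma coeffL_zero: "coeffL 0 \<mu> = 0"
  by (simp add: coeffL_def coeff_zero)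

lemma coeffL_sum: "coeffL (\<Sum>x\<in>F. f x) \<mu> = (\<Sum>x\<in>F. coeffL (f x) \<mu>)"
  by (induction F rule: infinite_finite_induct) (auto simp: coeffL_add coeffL_zero)

lemma coeffL_eqI: "(\<And>\<mu>. coeffL x \<mu> = coeffL y \<mu>) \<Longrightarrow> x = y"
  unfolding vec_eq_iff coeffL_def by (auto intro!: coeff_eqI)

lemma coeffL_mult_emon:
  "coeffL (c *s emon \<mu>) \<nu> = (if snd \<nu> = snd \<mu> then coeff (c * mon a (fst \<mu>)) (fst \<nu>) else 0)"
  by (simp add: coeffL_def emon_def axis_def coeff_zero)

lemma coeffL_emon: "coeffL (emon \<mu>) \<nu> = (if \<nu> = \<mu> then 1 else 0)"
  using coeffL_mult_emon[of 1 \<mu> \<nu>] by (auto simp: coeff_mon prod_eq_iff)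

lemma finite_coeffL:
  fixes v :: "'a ^ 's::finite"
  shows "finite {\<mu>. coeffL v \<mu> \<noteq> 0}"
proof -
  have "{\<mu>. coeffL v \<mu> \<noteq> 0} \<subseteq> (\<Union>i. {\<alpha>. coeff (v $ i) \<alpha> \<noteq> 0}) \<times> UNIV"
    by (auto simp: coeffL_def)
  moreover have "finite \<dots>" by (simp add: finite_coeff)
  ultimately show ?thesis by (rule finite_subset)
qed

lemma coeffL_expand: "v = (\<Sum>\<mu> | coeffL v \<mu> \<noteq> 0. scaleL (coeffL v \<mu>) (emon \<mu>))"
proof (rule coeffL_eqI)
  fix \<nu>
  show "coeffL v \<nu> = coeffL (\<Sum>\<mu> | coeffL v \<mu> \<noteq> 0. scaleL (coeffL v \<mu>) (emon \<mu>)) \<nu>"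
    by (simp add: coeffL_sum coeffL_scaleL coeffL_emon sum_mult_delta finite_coeffL)
qed

lemma scaleL_eq: "scaleL c v = scale c 1 *s v"
  by (simp add: scaleL_def vec_eq_iff scale_mult_left)

lemma mult_scaleL: "x *s scaleL c v = scaleL c (x *s v)"
  by (simp add: scaleL_def vec_eq_iff scale_mult_right)

lemma scale_mult_vec: "scale c x *s v = scaleL c (x *s v)"
  by (simp add: scaleL_def vec_eq_iff scale_mult_left)

lemma vector_space_scaleL: "vector_space (scaleL :: 'k \<Rightarrow> 'a ^ 's::finite \<Rightarrow> _)"
  by unfold_locales (auto simp: scaleL_def vec_eq_iff scale_right_distrib scale_left_distrib)

end

section \<open>Generated left submodules\<close>

lemma left_submodule_generated_mono:
  "G \<subseteq> H \<Longrightarrow> left_submodule_generated G \<subseteq> left_submodule_generated H"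
  unfolding left_submodule_generated_def by blast

lemma left_submodule_generated_zero: "0 \<in> left_submodule_generated G"
  unfolding left_submodule_generated_def by (auto intro!: exI[of _ "{}"])

lemma left_submodule_generated_base: "g \<in> G \<Longrightarrow> g \<in> left_submodule_generated G"
  unfolding left_submodule_generated_def by (auto intro!: exI[of _ "{g}"] exI[of _ "\<lambda>_. 1"])

lemma left_submodule_generated_mult:
  assumes "v \<in> left_submodule_generated G"
  shows "x *s v \<in> left_submodule_generated G"
proof -
  obtain F c where "finite F" "F \<subseteq> G" "v = (\<Sum>g\<in>F. c g *s g)"
    using assms unfolding left_submodule_generated_def by blast
  moreover from this have "x *s v = (\<Sum>g\<in>F. (x * c g) *s g)"
    by (simp add: vec_mult_sum) (simp add: vec_eq_iff mult.assoc)
  ultimately show ?thesis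
    unfolding left_submodule_generated_def
    by (intro CollectI exI[of _ F] exI[of _ "\<lambda>g. x * c g"]) simp
qed

lemma left_submodule_generated_add:
  assumes "u \<in> left_submodule_generated G" "v \<in> left_submodule_generated G"
  shows "u + v \<in> left_submodule_generated G"
proof -
  obtain E c F d where E: "finite E" "E \<subseteq> G" "u = (\<Sum>g\<in>E. c g *s g)"
    and F: "finite F" "F \<subseteq> G" "v = (\<Sum>g\<in>F. d g *s g)"
    using assms unfolding left_submodule_generated_def by blast
  \<comment> \<open>Both sums are extended by zero coefficients to the union of their index
    sets.\<close>
  let ?c = "\<lambda>g. (if g \<in> E then c g else 0) + (if g \<in> F then d g else 0)"
  have "u = (\<Sum>g\<in>E \<union> F. (if g \<in> E then c g else 0) *s g)"
    unfolding E(3) using E(1) F(1) by (intro sum.mono_neutral_cong_left) auto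
  moreover have "v = (\<Sum>g\<in>E \<union> F. (if g \<in> F then d g else 0) *s g)"
    unfolding F(3) using E(1) F(1) by (intro sum.mono_neutral_cong_left) auto
  ultimately have "u + v = (\<Sum>g\<in>E \<union> F. ?c g *s g)"
    by (simp add: vec_eq_iff sum.distrib distrib_right)
  then show ?thesis
    using E(1,2) F(1,2) unfolding left_submodule_generated_def
    by (auto intro!: exI[of _ "E \<union> F"] exI[of _ ?c])
qed

lemma left_submodule_generated_diff:
  assumes "u \<in> left_submodule_generated G" "v \<in> left_submodule_generated G"
  shows "u - v \<in> left_submodule_generated G"
proof -
  have "u + (- 1) *s v = u - v" by (simp add: vec_eq_iff)
  then show ?thesis
    using left_submodule_generated_add[OF assms(1) left_submodule_generated_mult[OF assms(2), of "- 1"]]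
    by simp
qed

lemma left_submodule_generated_minimal:
  assumes "G \<subseteq> Y" "0 \<in> Y" "\<And>u v. u \<in> Y \<Longrightarrow> v \<in> Y \<Longrightarrow> u + v \<in> Y"
    and "\<And>x g. g \<in> Y \<Longrightarrow> x *s g \<in> Y"
  shows "left_submodule_generated G \<subseteq> Y"
proof -
  have "(\<Sum>g\<in>F. c g *s g) \<in> Y" if "finite F" "F \<subseteq> G" for F c
    using that by (induction F rule: finite_induct) (use assms in auto)
  then show ?thesis unfolding left_submodule_generated_def by blast
qed

lemma left_submodule_generated_subset:
  "G \<subseteq> left_submodule_generated H \<Longrightarrow> left_submodule_generated G \<subseteq> left_submodule_generated H"
  by (intro left_submodule_generated_minimal left_submodule_generated_zero
      left_submodule_generated_add left_submodule_generated_mult)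

section \<open>Leading monomials and degrees\<close>

abbreviation eadd :: "'n expo \<Rightarrow> 'n expo \<Rightarrow> 'n expo" where
  "eadd \<alpha> \<beta> \<equiv> (\<lambda>k. \<alpha> k + \<beta> k)"

text \<open>The algebra need not be commutative, so a monomial times \<open>\<mu>\<close> may have
  several terms; \<open>shift \<gamma> \<mu>\<close> stands for the leading one of them.\<close>

definition shift :: "'n expo \<Rightarrow> ('n, 's) lmon \<Rightarrow> ('n, 's) lmon" where
  "shift \<gamma> \<mu> = (eadd \<gamma> (fst \<mu>), snd \<mu>)"

lemma shift_shift: "shift \<gamma> (shift \<delta> \<mu>) = shift (eadd \<gamma> \<delta>) \<mu>"
  by (simp add: shift_def add.assoc)

lemma shift_zero: "shift (\<lambda>_. 0) \<mu> = \<mu>"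
  by (simp add: shift_def)

lemma snd_shift: "snd (shift \<gamma> \<mu>) = snd \<mu>"
  by (simp add: shift_def)

lemma wdeg_eadd: "wdeg w (eadd \<alpha> \<beta>) = wdeg w \<alpha> + wdeg w \<beta>"
  by (simp add: wdeg_def distrib_left sum.distrib)

context graded_free_module
begin

interpretation L: vector_space "scaleL :: 'k \<Rightarrow> 'a ^ 's \<Rightarrow> 'a ^ 's"
  by (rule vector_space_scaleL)

lemma prec_order: "irreflp prec" "transp prec" "totalp prec" "wfp prec"
  using ordering by (auto simp: monomial_ordering_def)

lemma prece_order: "irreflp prece" "transp prece" "totalp prece"
  using left_ordering by (auto simp: left_monomial_ordering_def)

lemma prece_irrefl: "\<not> prece \<mu> \<mu>"
  using prece_order(1) by (rule irreflpD)

lemma prece_trans: "prece \<mu> \<nu> \<Longrightarrow> prece \<nu> \<kappa> \<Longrightarrow> prece \<mu> \<kappa>"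
  using prece_order(2) by (rule transpD)

lemma prece_total: "\<mu> \<noteq> \<nu> \<Longrightarrow> prece \<mu> \<nu> \<or> prece \<nu> \<mu>"
  using prece_order(3) by (rule totalpD)

lemma prec_imp_prece: "prec \<alpha> \<beta> \<Longrightarrow> prece (\<alpha>, i) (\<beta>, i)"
  using left_ordering by (simp add: left_monomial_ordering_def)

text \<open>Solvability writes the product as a nonzero multiple of the monomial
  \<open>eadd \<alpha> \<beta>\<close> plus a tail with smaller leading monomial. The tail cannot
  cancel the leading term.\<close>

lemma coeff_mon_mult:
  "coeff (mon a \<alpha> * mon a \<beta>) (eadd \<alpha> \<beta>) \<noteq> 0"
  "coeff (mon a \<alpha> * mon a \<beta>) \<gamma> \<noteq> 0 \<Longrightarrow> \<gamma> = eadd \<alpha> \<beta> \<or> prec \<gamma> (eadd \<alpha> \<beta>)"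
proof -
  obtain l f where l: "l \<noteq> 0" "mon a \<alpha> * mon a \<beta> = scale l (mon a (eadd \<alpha> \<beta>)) + f"
    and f: "f = 0 \<or> prec (LM prec f) (eadd \<alpha> \<beta>)"
    using solvable[of \<alpha> \<beta>] by blast
  \<comment> \<open>Every monomial of the tail is at most the leading one of the tail, which is
    below \<open>eadd \<alpha> \<beta>\<close>.\<close>
  have low: "prec \<nu> (eadd \<alpha> \<beta>)" if "coeff f \<nu> \<noteq> 0" for \<nu>
  proof -
    have "\<nu> = LM prec f \<or> prec \<nu> (LM prec f)"
      using leading_index_exists[where c = "coeff f", OF prec_order(1-3) finite_coeff that] that
      unfolding LM_def by blast
    moreover have "f \<noteq> 0" using that by (auto simp: coeff_zero)
    ultimately show ?thesis using f prec_order(2) by (metis transpD)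
  qed
  then have "coeff f (eadd \<alpha> \<beta>) = 0"
    using prec_order(1) by (metis irreflpD)
  then show "coeff (mon a \<alpha> * mon a \<beta>) (eadd \<alpha> \<beta>) \<noteq> 0"
    using l by (simp add: coeff_add coeff_scale coeff_mon)
  show "\<gamma> = eadd \<alpha> \<beta> \<or> prec \<gamma> (eadd \<alpha> \<beta>)" if "coeff (mon a \<alpha> * mon a \<beta>) \<gamma> \<noteq> 0"
    using that low[of \<gamma>] l(2) by (auto simp: coeff_add coeff_scale coeff_mon split: if_splits)
qed

lemma wdeg_mon_mult:
  assumes "coeff (mon a \<alpha> * mon a \<beta>) \<gamma> \<noteq> 0"
  shows "wdeg m \<gamma> = wdeg m \<alpha> + wdeg m \<beta>"
proof (rule coeff_span[OF _ assms])
  show "mon a \<alpha> * mon a \<beta> \<in> span {mon a \<gamma> | \<gamma>. wdeg m \<gamma> = wdeg m \<alpha> + wdeg m \<beta>}"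
    by (rule graded) (auto intro: span_base)
qed

definition ldeg :: "('n, 's) lmon \<Rightarrow> nat" where
  "ldeg \<mu> = wdeg m (fst \<mu>) + b (snd \<mu>)"

lemma ldeg_shift: "ldeg (shift \<gamma> \<mu>) = wdeg m \<gamma> + ldeg \<mu>"
  by (simp add: ldeg_def shift_def wdeg_eadd)

text \<open>The lower terms arising in products and divisions of homogeneous elements keep the
  degree. Recording this next to the order keeps all rewriting inside the truncation bound.\<close>

definition below :: "('n, 's) lmon \<Rightarrow> ('n, 's) lmon set" where
  "below \<mu> = {\<nu>. prece \<nu> \<mu> \<and> ldeg \<nu> = ldeg \<mu>}"

section \<open>Leading monomials of module elements and of their multiples\<close>

lemma lmI: "coeffL v \<mu> \<noteq> 0 \<Longrightarrow> (\<And>\<nu>. coeffL v \<nu> \<noteq> 0 \<Longrightarrow> \<nu> = \<mu> \<or> prece \<nu> \<mu>) \<Longrightarrow> lm v = \<mu>"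
  unfolding LML_def by (rule leading_index_eqI[OF prece_order(1,2)])

lemma ex_coeffL: "v \<noteq> 0 \<Longrightarrow> \<exists>\<mu>. coeffL v \<mu> \<noteq> 0"
  using coeffL_eqI[of v 0] by (auto simp: coeffL_zero)

lemma lc_nonzero: "v \<noteq> 0 \<Longrightarrow> coeffL v (lm v) \<noteq> 0"
  using leading_index_exists[OF prece_order finite_coeffL] ex_coeffL[of v]
  unfolding LML_def by blast

lemma coeffL_le_lm: "coeffL v \<nu> \<noteq> 0 \<Longrightarrow> \<nu> = lm v \<or> prece \<nu> (lm v)"
  using leading_index_exists[OF prece_order finite_coeffL, of v \<nu>]
  unfolding LML_def by blast

lemma coeffL_mon_mult_emon:
  "coeffL (mon a \<gamma> *s emon \<mu>) (shift \<gamma> \<mu>) \<noteq> 0"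
  "coeffL (mon a \<gamma> *s emon \<mu>) \<nu> \<noteq> 0 \<Longrightarrow> \<nu> = shift \<gamma> \<mu> \<or> \<nu> \<in> below (shift \<gamma> \<mu>)"
proof -
  show "coeffL (mon a \<gamma> *s emon \<mu>) (shift \<gamma> \<mu>) \<noteq> 0"
    by (simp add: coeffL_mult_emon shift_def coeff_mon_mult(1))
  assume "coeffL (mon a \<gamma> *s emon \<mu>) \<nu> \<noteq> 0"
  then have *: "snd \<nu> = snd \<mu>" "coeff (mon a \<gamma> * mon a (fst \<mu>)) (fst \<nu>) \<noteq> 0"
    by (auto simp: coeffL_mult_emon split: if_splits)
  have "fst \<nu> = eadd \<gamma> (fst \<mu>) \<or> prece (fst \<nu>, snd \<mu>) (eadd \<gamma> (fst \<mu>), snd \<mu>)"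
    using coeff_mon_mult(2)[OF *(2)] prec_imp_prece by blast
  moreover have "ldeg \<nu> = ldeg (shift \<gamma> \<mu>)"
    using wdeg_mon_mult[OF *(2)] *(1) by (simp add: ldeg_def shift_def wdeg_eadd)
  ultimately show "\<nu> = shift \<gamma> \<mu> \<or> \<nu> \<in> below (shift \<gamma> \<mu>)"
    using *(1) by (cases \<nu>) (auto simp: shift_def below_def)
qed

lemma lm_mon_mult_emon: "lm (mon a \<gamma> *s emon \<mu>) = shift \<gamma> \<mu>"
proof (rule lmI[OF coeffL_mon_mult_emon(1)])
  show "\<nu> = shift \<gamma> \<mu> \<or> prece \<nu> (shift \<gamma> \<mu>)" if "coeffL (mon a \<gamma> *s emon \<mu>) \<nu> \<noteq> 0" for \<nu>
    using coeffL_mon_mult_emon(2)[OF that] by (auto simp: below_def)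
qed

lemma mon_dvd_iff: "mon_dvd \<mu> \<nu> \<longleftrightarrow> (\<exists>\<gamma>. \<nu> = shift \<gamma> \<mu>)"
  by (auto simp: mon_dvd_def lm_mon_mult_emon snd_shift)

text \<open>The compatibility axiom speaks of leading monomials of products, and these are now known
  to be shifts.\<close>

lemma prece_shift: "prece \<mu> \<nu> \<Longrightarrow> prece (shift \<gamma> \<mu>) (shift \<gamma> \<nu>)"
  using left_ordering unfolding left_monomial_ordering_def by (metis lm_mon_mult_emon)

lemma below_shift: "\<mu> \<in> below \<nu> \<Longrightarrow> shift \<gamma> \<mu> \<in> below (shift \<gamma> \<nu>)"
  by (simp add: below_def prece_shift ldeg_shift)

lemma below_trans: "\<mu> \<in> below \<nu> \<Longrightarrow> \<nu> \<in> below \<kappa> \<Longrightarrow> \<mu> \<in> below \<kappa>"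
  by (auto simp: below_def intro: prece_trans)

text \<open>Addition of exponents is commutative, so \<open>shift \<alpha> \<mu>\<close> is also
  \<open>(\<alpha>, snd \<mu>)\<close> shifted by \<open>fst \<mu>\<close>. This turns a comparison
  of the multipliers into one of the shifted monomials.\<close>

lemma prec_imp_prece_shift: "prec \<alpha> \<beta> \<Longrightarrow> prece (shift \<alpha> \<mu>) (shift \<beta> \<mu>)"
  using prece_shift[OF prec_imp_prece, of \<alpha> \<beta> "fst \<mu>" "snd \<mu>"]
  by (simp add: shift_def add.commute)

lemma coeffL_mon_mult:
  "coeffL (mon a \<gamma> *s v) \<nu> =
    (\<Sum>\<mu> | coeffL v \<mu> \<noteq> 0. coeffL v \<mu> * coeffL (mon a \<gamma> *s emon \<mu>) \<nu>)"
proof -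
  have "mon a \<gamma> *s v = (\<Sum>\<mu> | coeffL v \<mu> \<noteq> 0. scaleL (coeffL v \<mu>) (mon a \<gamma> *s emon \<mu>))"
    by (subst coeffL_expand[of v]) (simp add: vec_mult_sum mult_scaleL)
  then show ?thesis by (simp add: coeffL_sum coeffL_scaleL)
qed

lemma coeffL_mon_multE:
  assumes "coeffL (mon a \<gamma> *s v) \<nu> \<noteq> 0"
  obtains \<mu> where "coeffL v \<mu> \<noteq> 0" "\<nu> = shift \<gamma> \<mu> \<or> \<nu> \<in> below (shift \<gamma> \<mu>)"
proof -
  obtain \<mu> where "coeffL v \<mu> \<noteq> 0" "coeffL v \<mu> * coeffL (mon a \<gamma> *s emon \<mu>) \<nu> \<noteq> 0"
    using assms by (subst (asm) coeffL_mon_mult) (auto elim: sum.not_neutral_contains_not_neutral)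
  then show ?thesis using that coeffL_mon_mult_emon(2) by auto
qed

text \<open>Only the leading term of \<open>v\<close> contributes to the shifted leading monomial:
  the products of all other terms lie strictly below it. Hence nothing cancels there.\<close>

lemma lm_mon_mult:
  assumes "v \<noteq> 0"
  shows "lm (mon a \<gamma> *s v) = shift \<gamma> (lm v)" and "mon a \<gamma> *s v \<noteq> 0"
proof -
  let ?\<kappa> = "shift \<gamma> (lm v)"
  have "coeffL (mon a \<gamma> *s emon \<mu>) ?\<kappa> = 0" if "coeffL v \<mu> \<noteq> 0" "\<mu> \<noteq> lm v" for \<mu>
  proof (rule ccontr)
    assume "coeffL (mon a \<gamma> *s emon \<mu>) ?\<kappa> \<noteq> 0"
    from coeffL_mon_mult_emon(2)[OF this] have "?\<kappa> = shift \<gamma> \<mu> \<or> prece ?\<kappa> (shift \<gamma> \<mu>)"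
      by (auto simp: below_def)
    moreover have "prece (shift \<gamma> \<mu>) ?\<kappa>"
      using coeffL_le_lm[OF that(1)] that(2) prece_shift by blast
    ultimately show False
      using prece_irrefl[of ?\<kappa>] prece_trans[of ?\<kappa> "shift \<gamma> \<mu>" ?\<kappa>] by metis
  qed
  then have "coeffL (mon a \<gamma> *s v) ?\<kappa> =
      (\<Sum>\<mu> | coeffL v \<mu> \<noteq> 0. if \<mu> = lm v then coeffL v \<mu> * coeffL (mon a \<gamma> *s emon \<mu>) ?\<kappa> else 0)"
    by (intro trans[OF coeffL_mon_mult] sum.cong) auto
  also have "\<dots> \<noteq> 0"
    using lc_nonzero[OF assms] coeffL_mon_mult_emon(1)[of \<gamma> "lm v"] finite_coeffL[of v] by simp
  finally have *: "coeffL (mon a \<gamma> *s v) ?\<kappa> \<noteq> 0" .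
  then show "mon a \<gamma> *s v \<noteq> 0" by (auto simp: coeffL_zero)
  show "lm (mon a \<gamma> *s v) = ?\<kappa>"
  proof (rule lmI[OF *])
    fix \<nu> assume "coeffL (mon a \<gamma> *s v) \<nu> \<noteq> 0"
    then obtain \<mu> where \<mu>: "coeffL v \<mu> \<noteq> 0" "\<nu> = shift \<gamma> \<mu> \<or> prece \<nu> (shift \<gamma> \<mu>)"
      by (auto elim!: coeffL_mon_multE simp: below_def)
    show "\<nu> = ?\<kappa> \<or> prece \<nu> ?\<kappa>"
      using \<mu>(2) coeffL_le_lm[OF \<mu>(1)] prece_shift[of \<mu> "lm v" \<gamma>]
        prece_trans[of \<nu> "shift \<gamma> \<mu>" ?\<kappa>] by metis
  qed
qed

text \<open>In a nonempty set every occupied component has an exponent minimal for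
  \<open>prec\<close>. The least of these finitely many candidates is minimal in the whole set,
  since \<open>prece\<close> extends \<open>prec\<close> within each component.\<close>

lemma wfp_prece: "wfp prece"
  unfolding wfp_iff_ex_minimal
proof (intro allI impI)
  fix B :: "('n, 's) lmon set" assume "B \<noteq> {}"
  define I where "I = {i. \<exists>\<alpha>. (\<alpha>, i) \<in> B}"
  have "\<exists>\<alpha>. (\<alpha>, i) \<in> B \<and> (\<forall>\<beta>. prec \<beta> \<alpha> \<longrightarrow> (\<beta>, i) \<notin> B)" if "i \<in> I" for i
    using that prec_order(4)[unfolded wfp_iff_ex_minimal, rule_format, of "{\<alpha>. (\<alpha>, i) \<in> B}"]
    by (auto simp: I_def)
  then obtain f where f: "\<And>i. i \<in> I \<Longrightarrow> (f i, i) \<in> B"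
      "\<And>i \<beta>. i \<in> I \<Longrightarrow> prec \<beta> (f i) \<Longrightarrow> (\<beta>, i) \<notin> B"
    by metis
  let ?F = "(\<lambda>i. (f i, i)) ` I"
  have "asymp_on ?F prece" "transp_on ?F prece"
    using prece_irrefl prece_trans by (blast intro!: asymp_onI, blast intro!: transp_onI)
  moreover have "?F \<noteq> {}" using \<open>B \<noteq> {}\<close> by (auto simp: I_def)
  ultimately obtain \<mu> where \<mu>: "\<mu> \<in> ?F" "\<forall>x\<in>?F. x \<noteq> \<mu> \<longrightarrow> \<not> prece x \<mu>"
    using Finite_Set.bex_min_element[of ?F prece] by auto
  have "\<nu> \<notin> B" if "prece \<nu> \<mu>" for \<nu>
  proof
    assume "\<nu> \<in> B"
    then have I: "snd \<nu> \<in> I" by (auto simp: I_def intro: exI[of _ "fst \<nu>"])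
    let ?\<kappa> = "(f (snd \<nu>), snd \<nu>)"
    have "\<not> prec (fst \<nu>) (f (snd \<nu>))" using f(2)[OF I] \<open>\<nu> \<in> B\<close> by fastforce
    then have "fst \<nu> = f (snd \<nu>) \<or> prec (f (snd \<nu>)) (fst \<nu>)"
      using totalpD[OF prec_order(3)] by blast
    then have "\<nu> = ?\<kappa> \<or> prece ?\<kappa> \<nu>"
      using prec_imp_prece[of "f (snd \<nu>)" "fst \<nu>" "snd \<nu>"] by (auto simp: prod_eq_iff)
    then have "prece ?\<kappa> \<mu>" using that prece_trans[of ?\<kappa> \<nu> \<mu>] by auto
    moreover from this have "?\<kappa> \<noteq> \<mu>" using prece_irrefl[of \<mu>] by auto
    ultimately show False using \<mu>(2) I by blast
  qed
  then show "\<exists>z\<in>B. \<forall>y. prece y z \<longrightarrow> y \<notin> B" using \<mu>(1) f(1) by blast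
qed

section \<open>Homogeneous elements described by their supports\<close>

lemma span_emon_iff: "v \<in> L.span (emon ` M) \<longleftrightarrow> (\<forall>\<mu>. coeffL v \<mu> \<noteq> 0 \<longrightarrow> \<mu> \<in> M)"
proof
  assume "v \<in> L.span (emon ` M)"
  then show "\<forall>\<mu>. coeffL v \<mu> \<noteq> 0 \<longrightarrow> \<mu> \<in> M"
  proof (induction rule: L.span_induct_alt)
    case base
    show ?case by (simp add: coeffL_zero)
  next
    case (step c x y)
    then show ?case by (auto simp: coeffL_add coeffL_scaleL coeffL_emon split: if_splits)
  qed
next
  assume *: "\<forall>\<mu>. coeffL v \<mu> \<noteq> 0 \<longrightarrow> \<mu> \<in> M"
  show "v \<in> L.span (emon ` M)"
    by (subst coeffL_expand[of v], intro L.span_sum L.span_scale L.span_base) (use * in auto)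
qed

lemma hom_part_iff: "v \<in> hom_part q \<longleftrightarrow> (\<forall>\<mu>. coeffL v \<mu> \<noteq> 0 \<longrightarrow> ldeg \<mu> = q)"
proof -
  have "{emon (\<alpha>, i) | \<alpha> i. wdeg m \<alpha> + b i = q} = emon ` {\<mu>. ldeg \<mu> = q}"
    by (force simp: ldeg_def)
  then show ?thesis unfolding hom_part_def using span_emon_iff[of v "{\<mu>. ldeg \<mu> = q}"] by simp
qed

lemma dgr_eqI: "v \<noteq> 0 \<Longrightarrow> v \<in> hom_part q \<Longrightarrow> dgr v = q"
  unfolding dgr_def hom_part_iff using ex_coeffL[of v] by (intro the_equality) auto

lemma homogeneous_coeffL:
  assumes "homogeneous v" "coeffL v \<mu> \<noteq> 0"
  shows "ldeg \<mu> = dgr v"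
proof -
  obtain q where q: "v \<in> hom_part q" using assms(1) by (auto simp: homogeneous_def)
  moreover have "v \<noteq> 0" using assms(2) by (auto simp: coeffL_zero)
  ultimately show ?thesis using assms(2) dgr_eqI[of v q] by (simp add: hom_part_iff del: split_paired_All)
qed

lemma ldeg_lm: "v \<noteq> 0 \<Longrightarrow> homogeneous v \<Longrightarrow> ldeg (lm v) = dgr v"
  using homogeneous_coeffL lc_nonzero by blast

lemma coeffL_homogeneous_le:
  assumes "v \<noteq> 0" "homogeneous v" "coeffL v \<nu> \<noteq> 0"
  shows "\<nu> = lm v \<or> \<nu> \<in> below (lm v)"
  using coeffL_le_lm[OF assms(3)] homogeneous_coeffL[OF assms(2,3)] ldeg_lm[OF assms(1,2)]
  by (auto simp: below_def)

lemma homogeneous_mon_mult: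
  assumes "v \<noteq> 0" "homogeneous v"
  shows "homogeneous (mon a \<gamma> *s v)"
  unfolding homogeneous_def hom_part_iff
proof (intro exI allI impI)
  fix \<nu> assume "coeffL (mon a \<gamma> *s v) \<nu> \<noteq> 0"
  then show "ldeg \<nu> = wdeg m \<gamma> + dgr v"
    by (elim coeffL_mon_multE) (auto simp: below_def ldeg_shift homogeneous_coeffL[OF assms(2)])
qed

section \<open>Division\<close>

text \<open>A reduction subtracts a multiple with the same leading monomial, scaled so that the
  leading terms cancel; a move deletes the leading term. In both cases only smaller monomials
  remain.\<close>

lemma div_step_decrease:
  assumes "div_step P (\<xi>, r) (\<xi>', r')" "0 \<notin> P" "coeffL \<xi>' \<nu> \<noteq> 0"
  shows "prece \<nu> (lm \<xi>)"
  using assms(1)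
proof cases
  case (reduce p \<gamma>)
  let ?q = "mon a \<gamma> *s p"
  have q: "coeffL ?q (lm \<xi>) \<noteq> 0"
    using reduce assms(2) lm_mon_mult(2) lc_nonzero by metis
  have "coeffL \<xi>' (lm \<xi>) = 0"
    unfolding reduce(1) coeffL_diff coeffL_scaleL LCL_def reduce(6)[symmetric] using q by simp
  then have "\<nu> \<noteq> lm \<xi>" using assms(3) by auto
  moreover have "coeffL \<xi> \<nu> \<noteq> 0 \<or> coeffL ?q \<nu> \<noteq> 0"
    using assms(3) unfolding reduce(1) coeffL_diff coeffL_scaleL by auto
  ultimately show ?thesis using coeffL_le_lm[of \<xi> \<nu>] coeffL_le_lm[of ?q \<nu>] reduce(6) by auto
next
  case move
  then have "coeffL \<xi>' \<nu> = (if \<nu> = lm \<xi> then 0 else coeffL \<xi> \<nu>)"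
    by (simp add: coeffL_diff LTL_def LCL_def coeffL_scaleL coeffL_emon)
  then show ?thesis using assms(3) coeffL_le_lm[of \<xi> \<nu>] by (auto split: if_splits)
qed

lemma div_step_nonzero: "div_step P (\<xi>, r) s \<Longrightarrow> \<xi> \<noteq> 0"
  by (auto elim: div_step.cases)

text \<open>In an infinite division every dividend has a successor and is therefore nonzero, so the
  leading monomials would descend forever.\<close>

lemma no_infinite_division:
  assumes "0 \<notin> P"
  shows "\<not> (\<exists>r. r 0 = (\<xi>, 0) \<and> (\<forall>k::nat. div_step P (r k) (r (Suc k))))"
proof
  assume "\<exists>r. r 0 = (\<xi>, 0) \<and> (\<forall>k::nat. div_step P (r k) (r (Suc k)))"
  then obtain r where r: "\<And>k::nat. div_step P (r k) (r (Suc k))" by blast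
  have "prece (lm (fst (r (Suc k)))) (lm (fst (r k)))" for k
  proof (rule div_step_decrease[of P _ "snd (r k)" _ "snd (r (Suc k))"])
    have "fst (r (Suc k)) \<noteq> 0" using div_step_nonzero r by (metis prod.collapse)
    then show "coeffL (fst (r (Suc k))) (lm (fst (r (Suc k)))) \<noteq> 0" by (rule lc_nonzero)
  qed (use r assms in auto)
  then have "\<exists>f. \<forall>k. prece (f (Suc k)) (f k)"
    by (intro exI[of _ "\<lambda>k. lm (fst (r k))"]) simp
  then show False
    using wfp_prece unfolding wfp_def wf_iff_no_infinite_down_chain mem_Collect_eq split by blast
qed

lemma ex_div_step:
  assumes "\<xi> \<noteq> 0" "0 \<notin> P"
  shows "\<exists>s. div_step P (\<xi>, r) s"
proof (cases "\<exists>p\<in>P. mon_dvd (lm p) (lm \<xi>)")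
  case True
  then obtain p \<gamma> where p: "p \<in> P" "mon_dvd (lm p) (lm \<xi>)" "lm \<xi> = shift \<gamma> (lm p)"
    by (auto simp: mon_dvd_iff)
  then have "lm \<xi> = lm (mon a \<gamma> *s p)"
    using assms(2) lm_mon_mult(1)[of p \<gamma>] by metis
  then show ?thesis using div_step.reduce[OF assms(1) p(1,2)] by blast
next
  case False
  then show ?thesis using div_step.move[OF assms(1)] by blast
qed

lemma ex_remainder:
  assumes "0 \<notin> P"
  shows "\<exists>\<eta>. remainder P \<xi> \<eta>"
proof -
  \<comment> \<open>The collected remainder \<open>r\<close> stays arbitrary, because the induction
    on the leading monomial continues from a state whose second component has changed.\<close>
  have nonzero: "\<exists>\<eta>. (div_step P)\<^sup>*\<^sup>* (\<xi>, r) (0, \<eta>)" if "\<xi> \<noteq> 0" for \<xi> r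
    using wfp_prece that
  proof (induction "lm \<xi>" arbitrary: \<xi> r rule: wfp_induct_rule)
    case less
    obtain \<xi>' r' where step: "div_step P (\<xi>, r) (\<xi>', r')"
      using ex_div_step[OF less(2) assms] by (metis surj_pair)
    show ?case
    proof (cases "\<xi>' = 0")
      case True
      then show ?thesis using step by blast
    next
      case False
      then have "prece (lm \<xi>') (lm \<xi>)"
        using div_step_decrease[OF step assms] lc_nonzero by blast
      then show ?thesis
        using less(1) False step converse_rtranclp_into_rtranclp[of "div_step P"] by metis
    qed
  qed
  show ?thesis
  proof (cases "\<xi> = 0")
    case True
    then show ?thesis unfolding remainder_def by blast
  next
    case False
    then show ?thesis unfolding remainder_def by (rule nonzero)
  qed
qed

section \<open>Spans of monomial multiples\<close>

text \<open>For nonzero \<open>k\<close>, \<open>shift \<epsilon> (lm k)\<close> is the leading monomial of \<open>a\<^sup>\<epsilon> k\<close>.\<close>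

definition multiples_span :: "('a ^ 's) set \<Rightarrow> ('n, 's) lmon set \<Rightarrow> ('a ^ 's) set" where
  "multiples_span G M = L.span {mon a \<epsilon> *s k | \<epsilon> k. k \<in> G \<and> shift \<epsilon> (lm k) \<in> M}"

lemma multiples_span_subsetI:
  assumes "\<And>k \<epsilon>. k \<in> G \<Longrightarrow> shift \<epsilon> (lm k) \<in> M \<Longrightarrow> k \<in> H \<and> shift \<epsilon> (lm k) \<in> N"
  shows "multiples_span G M \<subseteq> multiples_span H N"
  unfolding multiples_span_def by (rule L.span_mono) (use assms in blast)

lemma multiples_span_mono: "G \<subseteq> H \<Longrightarrow> M \<subseteq> N \<Longrightarrow> multiples_span G M \<subseteq> multiples_span H N"
  by (rule multiples_span_subsetI) blast

lemma multiples_span_base: "k \<in> G \<Longrightarrow> shift \<epsilon> (lm k) \<in> M \<Longrightarrow> mon a \<epsilon> *s k \<in> multiples_span G M"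
  unfolding multiples_span_def by (rule L.span_base) blast

lemma multiples_span_zero: "0 \<in> multiples_span G M"
  unfolding multiples_span_def by (rule L.span_zero)

lemma multiples_span_add:
  "x \<in> multiples_span G M \<Longrightarrow> y \<in> multiples_span G M \<Longrightarrow> x + y \<in> multiples_span G M"
  unfolding multiples_span_def by (rule L.span_add)

lemma multiples_span_diff:
  "x \<in> multiples_span G M \<Longrightarrow> y \<in> multiples_span G M \<Longrightarrow> x - y \<in> multiples_span G M"
  unfolding multiples_span_def by (rule L.span_diff)

lemma multiples_span_scale: "x \<in> multiples_span G M \<Longrightarrow> scaleL c x \<in> multiples_span G M"
  unfolding multiples_span_def by (rule L.span_scale)

lemma mon_zero: "mon a (\<lambda>_. 0) = 1"
proof -
  have "prod_list (map (\<lambda>i. 1 :: 'a) xs) = 1" for xs :: "'n list"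
    by (induction xs) auto
  then show ?thesis by (simp add: mon_def)
qed

lemma multiples_span_self: "k \<in> G \<Longrightarrow> lm k \<in> M \<Longrightarrow> k \<in> multiples_span G M"
  using multiples_span_base[of k G "\<lambda>_. 0" M] by (simp add: shift_zero mon_zero)

lemma mult_mon_expand:
  "x *s k = (\<Sum>\<nu> | coeff x \<nu> \<noteq> 0. scaleL (coeff x \<nu>) (mon a \<nu> *s k))"
  by (subst coeff_expand[of x]) (simp add: vec_sum_mult scale_mult_vec)

text \<open>The product of the two monomials is expanded in the monomial basis. Its leading
  coefficient serves as \<open>l\<close>; the other exponents are smaller for \<open>prec\<close>
  and have the same weighted degree, so they give multiples of \<open>k\<close> below.\<close>

lemma mon_mult_mon_mult:
  obtains l where "l \<noteq> 0" "mon a \<theta> *s (mon a \<epsilon> *s k) - scaleL l (mon a (eadd \<theta> \<epsilon>) *s k)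
    \<in> multiples_span {k} (below (shift (eadd \<theta> \<epsilon>) (lm k)))"
proof
  let ?x = "mon a \<theta> * mon a \<epsilon>" and ?\<kappa> = "eadd \<theta> \<epsilon>"
  show "coeff ?x ?\<kappa> \<noteq> 0" by (rule coeff_mon_mult(1))
  have "mon a \<theta> *s (mon a \<epsilon> *s k) = ?x *s k"
    by (simp add: vec_eq_iff mult.assoc)
  also have "\<dots> = (\<Sum>\<nu> | coeff ?x \<nu> \<noteq> 0. scaleL (coeff ?x \<nu>) (mon a \<nu> *s k))"
    by (rule mult_mon_expand)
  also have "\<dots> = scaleL (coeff ?x ?\<kappa>) (mon a ?\<kappa> *s k)
      + (\<Sum>\<nu> \<in> {\<nu>. coeff ?x \<nu> \<noteq> 0} - {?\<kappa>}. scaleL (coeff ?x \<nu>) (mon a \<nu> *s k))"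
    by (rule sum.remove) (use finite_coeff coeff_mon_mult(1) in auto)
  finally have "mon a \<theta> *s (mon a \<epsilon> *s k) - scaleL (coeff ?x ?\<kappa>) (mon a ?\<kappa> *s k)
      = (\<Sum>\<nu> \<in> {\<nu>. coeff ?x \<nu> \<noteq> 0} - {?\<kappa>}. scaleL (coeff ?x \<nu>) (mon a \<nu> *s k))"
    by simp
  also have "\<dots> \<in> multiples_span {k} (below (shift ?\<kappa> (lm k)))"
    unfolding multiples_span_def
  proof (intro L.span_sum L.span_scale L.span_base)
    fix \<nu> assume "\<nu> \<in> {\<nu>. coeff ?x \<nu> \<noteq> 0} - {?\<kappa>}"
    then have "prec \<nu> ?\<kappa>" "wdeg m \<nu> = wdeg m ?\<kappa>"
      using coeff_mon_mult(2)[of \<theta> \<epsilon> \<nu>] wdeg_mon_mult[of \<theta> \<epsilon> \<nu>] by (auto simp: wdeg_eadd)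
    then have "shift \<nu> (lm k) \<in> below (shift ?\<kappa> (lm k))"
      using prec_imp_prece_shift[of \<nu> ?\<kappa> "lm k"] by (simp add: below_def ldeg_shift)
    then show "mon a \<nu> *s k \<in> {mon a \<epsilon> *s k' | \<epsilon> k'. k' \<in> {k} \<and>
        shift \<epsilon> (lm k') \<in> below (shift ?\<kappa> (lm k))}" by blast
  qed
  finally show "mon a \<theta> *s (mon a \<epsilon> *s k) - scaleL (coeff ?x ?\<kappa>) (mon a ?\<kappa> *s k)
    \<in> multiples_span {k} (below (shift ?\<kappa> (lm k)))" .
qed

text \<open>Each spanning multiple becomes, up to lower multiples of the same element, a scalar
  times the multiple with added exponents, and shifting by \<open>\<theta>\<close> preserves
  \<open>below\<close>.\<close>

lemma multiples_span_mon_mult: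
  assumes "v \<in> multiples_span G (below \<tau>)"
  shows "mon a \<theta> *s v \<in> multiples_span G (below (shift \<theta> \<tau>))"
  using assms unfolding multiples_span_def[of G "below \<tau>"]
proof (induction rule: L.span_induct_alt)
  case base
  show ?case by (simp add: multiples_span_zero)
next
  case (step c x y)
  then obtain \<epsilon> k where k: "x = mon a \<epsilon> *s k" "k \<in> G" "shift \<epsilon> (lm k) \<in> below \<tau>" by blast
  let ?\<kappa> = "shift (eadd \<theta> \<epsilon>) (lm k)"
  have \<kappa>: "?\<kappa> \<in> below (shift \<theta> \<tau>)"
    using below_shift[OF k(3), of \<theta>] by (simp add: shift_shift)
  obtain l where l: "mon a \<theta> *s x - scaleL l (mon a (eadd \<theta> \<epsilon>) *s k) \<in> multiples_span {k} (below ?\<kappa>)"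
    unfolding k(1) by (rule mon_mult_mon_mult)
  have "multiples_span {k} (below ?\<kappa>) \<subseteq> multiples_span G (below (shift \<theta> \<tau>))"
    by (rule multiples_span_mono) (use k(2) below_trans[OF _ \<kappa>] in blast)+
  then have "mon a \<theta> *s x \<in> multiples_span G (below (shift \<theta> \<tau>))"
    using multiples_span_add[OF subsetD[OF _ l] multiples_span_scale[OF multiples_span_base[OF k(2) \<kappa>], of l]]
    by simp
  moreover have "mon a \<theta> *s (scaleL c x + y) = scaleL c (mon a \<theta> *s x) + mon a \<theta> *s y"
    by (simp add: mult_scaleL[symmetric]) (simp add: vec_eq_iff distrib_left)
  ultimately show ?case using step.IH multiples_span_add multiples_span_scale by simp
qed

text \<open>Two choices of \<open>M\<close> matter: \<open>below \<mu>\<close> for S-polynomials, and all monomials of a given degree for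
  input elements.\<close>

lemma remainder_representation:
  assumes "remainder P \<xi> \<eta>"
    and P: "\<And>p. p \<in> P \<Longrightarrow> p \<noteq> 0 \<and> homogeneous p"
    and M: "\<And>\<mu>. \<mu> \<in> M \<Longrightarrow> below \<mu> \<subseteq> M"
    and \<xi>: "\<And>\<mu>. coeffL \<xi> \<mu> \<noteq> 0 \<Longrightarrow> \<mu> \<in> M"
  shows "\<xi> - \<eta> \<in> multiples_span P M"
    and "coeffL \<eta> \<mu> \<noteq> 0 \<Longrightarrow> \<mu> \<in> M \<and> (\<forall>p\<in>P. \<not> mon_dvd (lm p) \<mu>)"
proof -
  have "(div_step P)\<^sup>*\<^sup>* (\<xi>, 0) (0, \<eta>)" using assms(1) by (simp add: remainder_def)
  \<comment> \<open>Invariant of the division: the part subtracted so far is a combination of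
    multiples led by monomials in \<open>M\<close>, the dividend is supported in \<open>M\<close>,
    and the collected remainder is supported on irreducible monomials of \<open>M\<close>.\<close>
  then have "\<xi> - 0 - \<eta> \<in> multiples_span P M \<and> (\<forall>\<mu>. coeffL 0 \<mu> \<noteq> 0 \<longrightarrow> \<mu> \<in> M) \<and>
      (\<forall>\<mu>. coeffL \<eta> \<mu> \<noteq> 0 \<longrightarrow> \<mu> \<in> M \<and> (\<forall>p\<in>P. \<not> mon_dvd (lm p) \<mu>))"
  proof (induction rule: rtranclp_induct2)
    case refl
    show ?case using \<xi> by (simp add: multiples_span_zero coeffL_zero)
  next
    case (step \<zeta> r \<zeta>' r')
    note IH = step.IH[THEN conjunct1] step.IH[THEN conjunct2, THEN conjunct1, rule_format]
      step.IH[THEN conjunct2, THEN conjunct2, rule_format]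
    from step.hyps(2) show ?case
    proof cases
      case (reduce p \<gamma>)
      let ?q = "mon a \<gamma> *s p" and ?c = "lc \<zeta> / lc (mon a \<gamma> *s p)"
      have p: "p \<noteq> 0" "homogeneous p" using P reduce by auto
      have \<zeta>: "lm \<zeta> \<in> M" using IH(2) lc_nonzero reduce by blast
      have "?q \<in> multiples_span P M"
        by (rule multiples_span_base) (use reduce lm_mon_mult(1)[OF p(1)] \<zeta> in auto)
      then have "(\<xi> - \<zeta> - r) + scaleL ?c ?q \<in> multiples_span P M"
        by (intro multiples_span_add multiples_span_scale IH(1))
      moreover have "\<mu> \<in> M" if "coeffL \<zeta>' \<mu> \<noteq> 0" for \<mu>
      proof -
        have "coeffL \<zeta> \<mu> \<noteq> 0 \<or> coeffL ?q \<mu> \<noteq> 0"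
          using that unfolding reduce(1) by (auto simp: coeffL_diff coeffL_scaleL)
        then show ?thesis
        proof
          assume "coeffL ?q \<mu> \<noteq> 0"
          \<comment> \<open>The multiple of the homogeneous \<open>p\<close> has the leading
            monomial of \<open>\<zeta>\<close>, and its other monomials share that degree, so
            closure of \<open>M\<close> under \<open>below\<close> applies.\<close>
          then have "\<mu> = lm \<zeta> \<or> \<mu> \<in> below (lm \<zeta>)"
            unfolding reduce(6)
            by (rule coeffL_homogeneous_le[OF lm_mon_mult(2)[OF p(1)] homogeneous_mon_mult[OF p]])
          then show ?thesis using M[OF \<zeta>] \<zeta> by blast
        qed (rule IH(2))
      qed
      ultimately show ?thesis using IH(3) unfolding reduce(1,2) by (simp add: algebra_simps)
    next
      case move
      have \<zeta>: "lm \<zeta> \<in> M" using IH(2) lc_nonzero move by blast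
      have lt: "coeffL (lt \<zeta>) \<mu> \<noteq> 0 \<Longrightarrow> \<mu> = lm \<zeta>" for \<mu>
        by (auto simp: LTL_def coeffL_scaleL coeffL_emon split: if_splits)
      have "\<mu> \<in> M" if "coeffL \<zeta>' \<mu> \<noteq> 0" for \<mu>
        using that lt[of \<mu>] \<zeta> IH(2) unfolding move(1) coeffL_diff by fastforce
      moreover have "\<mu> \<in> M \<and> (\<forall>p\<in>P. \<not> mon_dvd (lm p) \<mu>)" if "coeffL r' \<mu> \<noteq> 0" for \<mu>
        using that lt[of \<mu>] \<zeta> IH(3)[of \<mu>] move(4) unfolding move(2) coeffL_add by fastforce
      ultimately show ?thesis using IH(1) unfolding move(1,2) by (simp add: algebra_simps)
    qed
  qed
  then show "\<xi> - \<eta> \<in> multiples_span P M"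
    and "coeffL \<eta> \<mu> \<noteq> 0 \<Longrightarrow> \<mu> \<in> M \<and> (\<forall>p\<in>P. \<not> mon_dvd (lm p) \<mu>)"
    by (simp, blast)
qed

section \<open>The truncated Buchberger criterion\<close>

definition lcm_mon :: "'a ^ 's \<Rightarrow> 'a ^ 's \<Rightarrow> ('n, 's) lmon" where
  "lcm_mon g h = (lcm_expo g h, snd (lm g))"

lemma ldeg_lcm_mon: "ldeg (lcm_mon g h) = spoly_deg g h"
  by (simp add: ldeg_def lcm_mon_def spoly_deg_def)

lemma lcm_expo_commute: "lcm_expo g h = lcm_expo h g"
  by (simp add: lcm_expo_def max.commute)

lemma lcm_mon_commute: "snd (lm g) = snd (lm h) \<Longrightarrow> lcm_mon g h = lcm_mon h g"
  by (simp add: lcm_mon_def lcm_expo_commute)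

text \<open>The truncated subtraction is exact because the maximum dominates
  \<open>fst (lm g)\<close>.\<close>

lemma shift_lcm_mon: "shift (\<lambda>k. lcm_expo g h k - fst (lm g) k) (lm g) = lcm_mon g h"
  by (auto simp: shift_def lcm_mon_def lcm_expo_def)

lemma spoly_antisym: "spoly h g = - spoly g h"
  by (simp add: spoly_def)

text \<open>Both multiples are scaled to have coefficient one at their common leading monomial
  \<open>lcm_mon g h\<close>, where the difference vanishes. Homogeneity keeps the remaining
  monomials in the same degree.\<close>

lemma coeffL_spoly:
  assumes "g \<noteq> 0" "homogeneous g" "h \<noteq> 0" "homogeneous h" "snd (lm g) = snd (lm h)"
    and "coeffL (spoly g h) \<mu> \<noteq> 0"
  shows "\<mu> \<in> below (lcm_mon g h)"
proof -
  have multiple: "lm (lcm_multiple u v) = lcm_mon u v \<and> lc (lcm_multiple u v) \<noteq> 0 \<and>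
      (coeffL (lcm_multiple u v) \<nu> \<noteq> 0 \<longrightarrow> \<nu> = lcm_mon u v \<or> \<nu> \<in> below (lcm_mon u v))"
    if "u \<noteq> 0" "homogeneous u" for u v \<nu>
  proof -
    have "lm (lcm_multiple u v) = lcm_mon u v" "lcm_multiple u v \<noteq> 0"
      using lm_mon_mult[OF that(1)] by (simp_all add: lcm_multiple_def shift_lcm_mon)
    moreover have "homogeneous (lcm_multiple u v)"
      using homogeneous_mon_mult[OF that] by (simp add: lcm_multiple_def)
    ultimately show ?thesis
      using coeffL_homogeneous_le[of "lcm_multiple u v" \<nu>] lc_nonzero[of "lcm_multiple u v"]
      by (auto simp: LCL_def)
  qed
  note g = multiple[OF assms(1,2)] and h = multiple[OF assms(3,4), of g, folded lcm_mon_commute[OF assms(5)]]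
  have "coeffL (lcm_multiple g h) \<mu> \<noteq> 0 \<or> coeffL (lcm_multiple h g) \<mu> \<noteq> 0"
    using assms(6) unfolding spoly_def coeffL_diff coeffL_scaleL by auto
  then have "\<mu> = lcm_mon g h \<or> \<mu> \<in> below (lcm_mon g h)" using g h by blast
  moreover have "coeffL (spoly g h) (lcm_mon g h) = 0"
    using g[THEN conjunct1, of h] g[THEN conjunct2, THEN conjunct1, of h]
      h[THEN conjunct1] h[THEN conjunct2, THEN conjunct1]
    by (simp add: spoly_def coeffL_diff coeffL_scaleL LCL_def)
  ultimately show ?thesis using assms(6) by auto
qed

text \<open>Multiplying the S-polynomial by a suitable monomial turns it, up to multiples below the
  common leading monomial, into a combination of the two given multiples. The coefficient of the
  first is nonzero and can be divided out.\<close>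

lemma pair_reduction:
  assumes "g \<in> G" "h \<in> G" "g \<noteq> 0" "h \<noteq> 0"
    and eq: "shift \<gamma> (lm g) = shift \<delta> (lm h)"
    and spoly: "spoly g h \<in> multiples_span G (below (lcm_mon g h))"
  shows "\<exists>c. mon a \<gamma> *s g - scaleL c (mon a \<delta> *s h) \<in> multiples_span G (below (shift \<gamma> (lm g)))"
proof -
  have snd: "snd (lm g) = snd (lm h)" using arg_cong[OF eq, of snd] by (simp add: snd_shift)
  have expo: "\<gamma> k + fst (lm g) k = \<delta> k + fst (lm h) k" for k
    using fun_cong[OF arg_cong[OF eq, of fst], of k] by (simp add: shift_def)
  \<comment> \<open>The exponent by which the common leading monomial exceeds the lcm; it is nowhere
    truncated since both leading monomials divide the common one.\<close>
  define \<theta> where "\<theta> = (\<lambda>k. \<gamma> k + fst (lm g) k - lcm_expo g h k)"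
  let ?g = "\<lambda>k. lcm_expo g h k - fst (lm g) k" and ?h = "\<lambda>k. lcm_expo h g k - fst (lm h) k"
  have \<gamma>: "eadd \<theta> ?g = \<gamma>"
  proof
    show "\<theta> k + ?g k = \<gamma> k" for k
      using expo[of k] by (simp add: \<theta>_def lcm_expo_def max_def)
  qed
  have \<delta>: "eadd \<theta> ?h = \<delta>"
  proof
    show "\<theta> k + ?h k = \<delta> k" for k
      using expo[of k] by (simp add: \<theta>_def lcm_expo_def max_def)
  qed
  have \<theta>: "shift \<theta> (lcm_mon g h) = shift \<gamma> (lm g)"
    by (simp only: shift_lcm_mon[symmetric] shift_shift \<gamma>)
  let ?T = "multiples_span G (below (shift \<gamma> (lm g)))"
  obtain l1 where l1: "l1 \<noteq> 0"
    "mon a \<theta> *s (mon a ?g *s g) - scaleL l1 (mon a (eadd \<theta> ?g) *s g)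
      \<in> multiples_span {g} (below (shift (eadd \<theta> ?g) (lm g)))"
    by (rule mon_mult_mon_mult)
  obtain l2 where l2:
    "mon a \<theta> *s (mon a ?h *s h) - scaleL l2 (mon a (eadd \<theta> ?h) *s h)
      \<in> multiples_span {h} (below (shift (eadd \<theta> ?h) (lm h)))"
    by (rule mon_mult_mon_mult)
  have t1: "mon a \<theta> *s (mon a ?g *s g) - scaleL l1 (mon a \<gamma> *s g) \<in> ?T"
    using l1(2) multiples_span_mono[of "{g}" G "below (shift \<gamma> (lm g))"] assms(1)
    unfolding \<gamma> by blast
  have t2: "mon a \<theta> *s (mon a ?h *s h) - scaleL l2 (mon a \<delta> *s h) \<in> ?T"
    using l2 multiples_span_mono[of "{h}" G "below (shift \<gamma> (lm g))"] assms(2)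
    unfolding \<delta> eq by blast
  define p where "p = 1 / lc (lcm_multiple g h)"
  define q where "q = 1 / lc (lcm_multiple h g)"
  have "p \<noteq> 0"
    using lc_nonzero[OF lm_mon_mult(2)[OF assms(3)]] by (simp add: p_def LCL_def lcm_multiple_def)
  have "mon a \<theta> *s spoly g h \<in> ?T"
    using multiples_span_mon_mult[OF spoly, of \<theta>] by (simp add: \<theta>)
  moreover have "mon a \<theta> *s spoly g h
      = scaleL p (mon a \<theta> *s (mon a ?g *s g)) - scaleL q (mon a \<theta> *s (mon a ?h *s h))"
  proof -
    have "x *s (u - v) = x *s u - x *s v" for x :: 'a and u v :: "'a ^ 's"
      by (simp add: vec_eq_iff right_diff_distrib)
    then show ?thesis by (simp add: spoly_def p_def q_def lcm_multiple_def mult_scaleL)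
  qed
  ultimately have "scaleL p (mon a \<theta> *s (mon a ?g *s g)) - scaleL q (mon a \<theta> *s (mon a ?h *s h)) \<in> ?T"
    by simp
  \<comment> \<open>The iterated products are replaced by \<open>mon a \<gamma> *s g\<close> and
    \<open>mon a \<delta> *s h\<close>, at the cost of elements of \<open>?T\<close>.\<close>
  from multiples_span_add[OF multiples_span_diff[OF this multiples_span_scale[OF t1, of p]]
      multiples_span_scale[OF t2, of q]]
  have "scaleL (p * l1) (mon a \<gamma> *s g) - scaleL (q * l2) (mon a \<delta> *s h) \<in> ?T"
    by (simp add: L.scale_right_diff_distrib)
  from multiples_span_scale[OF this, of "1 / (p * l1)"]
  show ?thesis using \<open>p \<noteq> 0\<close> l1(1) by (auto simp: L.scale_right_diff_distrib)
qed

text \<open>Among the terms with nonzero coefficient one has the greatest leading monomial. As the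
  leading monomials are distinct, no other term reaches that monomial and it survives in the
  sum.\<close>

lemma lm_span_distinct:
  assumes f: "f \<in> L.span X" "f \<noteq> 0" and X: "0 \<notin> X" "inj_on lm X"
  shows "lm f \<in> lm ` X"
proof -
  obtain t c where t: "finite t" "t \<subseteq> X" and f_eq: "f = (\<Sum>x\<in>t. scaleL (c x) x)"
    using f(1) unfolding L.span_explicit by blast
  let ?Y = "lm ` {x \<in> t. c x \<noteq> 0}"
  have "?Y \<noteq> {}"
  proof
    assume "?Y = {}"
    then have "f = 0" unfolding f_eq by (intro sum.neutral) auto
    then show False using f(2) by simp
  qed
  moreover have "asymp_on ?Y prece" "transp_on ?Y prece"
    using prece_irrefl prece_trans by (blast intro!: asymp_onI, blast intro!: transp_onI)
  ultimately obtain y where y: "y \<in> t" "c y \<noteq> 0"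
    and max: "\<And>x. x \<in> t \<Longrightarrow> c x \<noteq> 0 \<Longrightarrow> lm x \<noteq> lm y \<Longrightarrow> \<not> prece (lm y) (lm x)"
    using Finite_Set.bex_max_element[of ?Y prece] t(1) by auto
  have le: "lm x = lm y \<or> prece (lm x) (lm y)" if "x \<in> t" "c x \<noteq> 0" for x
    using max[OF that] prece_total by blast
  have "lm f = lm y"
  proof (rule lmI)
    have "coeffL x (lm y) = 0" if "x \<in> t" "c x \<noteq> 0" "x \<noteq> y" for x
    proof (rule ccontr)
      assume "coeffL x (lm y) \<noteq> 0"
      moreover have "lm x \<noteq> lm y" using that y t X(2) by (auto dest: inj_onD)
      ultimately show False
        using coeffL_le_lm[of x "lm y"] max[OF that(1,2)] by auto
    qed
    then have "coeffL f (lm y) = (\<Sum>x\<in>t. if x = y then c y * coeffL y (lm y) else 0)"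
      unfolding f_eq coeffL_sum coeffL_scaleL by (intro sum.cong) auto
    also have "\<dots> = c y * coeffL y (lm y)" using t(1) y(1) by simp
    finally show "coeffL f (lm y) \<noteq> 0" using y t X(1) lc_nonzero[of y] by auto
    fix \<nu> assume "coeffL f \<nu> \<noteq> 0"
    then obtain x where x: "x \<in> t" "c x \<noteq> 0" "coeffL x \<nu> \<noteq> 0"
      unfolding f_eq coeffL_sum coeffL_scaleL
      by (auto elim!: sum.not_neutral_contains_not_neutral)
    then show "\<nu> = lm y \<or> prece \<nu> (lm y)"
      using coeffL_le_lm[OF x(3)] le[OF x(1,2)] prece_trans[of \<nu> "lm x" "lm y"] by auto
  qed
  then show ?thesis using y t by auto
qed

lemma truncated_Buchberger_criterion:
  assumes G: "0 \<notin> G"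
    and pairs: "\<And>g h. g \<in> G \<Longrightarrow> h \<in> G \<Longrightarrow> snd (lm g) = snd (lm h) \<Longrightarrow> spoly_deg g h \<le> n0 \<Longrightarrow>
        spoly g h \<in> multiples_span G (below (lcm_mon g h))"
    and f: "f \<in> multiples_span G {\<mu>. ldeg \<mu> = q}" "q \<le> n0" "f \<noteq> 0"
  shows "\<exists>g\<in>G. mon_dvd (lm g) (lm f)"
proof -
  \<comment> \<open>\<open>D\<close> consists of the degree \<open>q\<close> monomials that lead
    some multiple of a generator; \<open>r\<close> will fix one such multiple for each of
    them.\<close>
  define D where "D = {\<mu>. ldeg \<mu> = q \<and> (\<exists>\<epsilon> k. k \<in> G \<and> \<mu> = shift \<epsilon> (lm k))}"
  have "\<forall>\<mu>\<in>D. \<exists>v. \<exists>\<epsilon> k. k \<in> G \<and> \<mu> = shift \<epsilon> (lm k) \<and> v = mon a \<epsilon> *s k"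
    unfolding D_def by blast
  from bchoice[OF this] obtain r
    where r: "\<And>\<mu>. \<mu> \<in> D \<Longrightarrow> \<exists>\<epsilon> k. k \<in> G \<and> \<mu> = shift \<epsilon> (lm k) \<and> r \<mu> = mon a \<epsilon> *s k"
    by blast
  have lm_r: "lm (r \<mu>) = \<mu> \<and> r \<mu> \<noteq> 0" if \<mu>: "\<mu> \<in> D" for \<mu>
  proof -
    obtain \<epsilon> k where "k \<in> G" "\<mu> = shift \<epsilon> (lm k)" "r \<mu> = mon a \<epsilon> *s k" using r[OF \<mu>] by blast
    then show ?thesis using lm_mon_mult[of k \<epsilon>] G by auto
  qed
  \<comment> \<open>Any multiple led by \<open>\<mu>\<close> is proportional to the chosen
    \<open>r \<mu>\<close> modulo multiples led by smaller monomials of the same degree, to which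
    the induction hypothesis applies.\<close>
  have span: "mon a \<gamma> *s g \<in> L.span (r ` D)" if "g \<in> G" "\<mu> = shift \<gamma> (lm g)" "ldeg \<mu> = q" for \<mu> \<gamma> g
    using wfp_prece that
  proof (induction \<mu> arbitrary: \<gamma> g rule: wfp_induct_rule)
    case (less \<mu>)
    have \<mu>: "\<mu> \<in> D" using less.prems by (auto simp: D_def)
    obtain \<delta> h where h: "h \<in> G" "\<mu> = shift \<delta> (lm h)" "r \<mu> = mon a \<delta> *s h"
      using r[OF \<mu>] by blast
    have eq: "shift \<gamma> (lm g) = shift \<delta> (lm h)" using less.prems h by simp
    have snd: "snd (lm g) = snd (lm h)" using arg_cong[OF eq, of snd] by (simp add: snd_shift)
    \<comment> \<open>The lcm divides \<open>\<mu>\<close>, so its degree is at most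
      \<open>q\<close>; thus only S-polynomials within the truncation bound are called for.\<close>
    have "spoly_deg g h \<le> n0"
    proof -
      have "lcm_expo g h k \<le> fst \<mu> k" for k
      proof -
        have "fst \<mu> k = \<gamma> k + fst (lm g) k"
          by (simp only: less.prems(2) shift_def fst_conv)
        moreover have "fst \<mu> k = \<delta> k + fst (lm h) k"
          by (simp only: h(2) shift_def fst_conv)
        ultimately show ?thesis by (simp add: lcm_expo_def)
      qed
      then have "wdeg m (lcm_expo g h) \<le> wdeg m (fst \<mu>)"
        unfolding wdeg_def by (intro sum_mono mult_left_mono) auto
      moreover have "snd \<mu> = snd (lm g)" using less.prems(2) by (simp add: snd_shift)
      ultimately show ?thesis using less.prems(3) f(2) by (simp add: spoly_deg_def ldeg_def)
    qed
    then have "spoly g h \<in> multiples_span G (below (lcm_mon g h))"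
      by (rule pairs[OF less.prems(1) h(1) snd])
    moreover have "g \<noteq> 0" "h \<noteq> 0" using G less.prems(1) h(1) by auto
    ultimately obtain c where c: "mon a \<gamma> *s g - scaleL c (r \<mu>) \<in> multiples_span G (below \<mu>)"
      using pair_reduction[OF less.prems(1) h(1) _ _ eq] less.prems(2) h(3) by auto
    moreover have "multiples_span G (below \<mu>) \<subseteq> L.span (r ` D)"
      unfolding multiples_span_def
    proof (rule L.span_minimal)
      show "{mon a \<epsilon> *s k |\<epsilon> k. k \<in> G \<and> shift \<epsilon> (lm k) \<in> below \<mu>} \<subseteq> L.span (r ` D)"
      proof clarify
        fix \<epsilon> k assume "k \<in> G" "shift \<epsilon> (lm k) \<in> below \<mu>"
        then show "mon a \<epsilon> *s k \<in> L.span (r ` D)"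
          using less.IH[OF _ _ refl] less.prems(3) by (simp add: below_def)
      qed
    qed (rule L.subspace_span)
    ultimately have "mon a \<gamma> *s g - scaleL c (r \<mu>) \<in> L.span (r ` D)" by blast
    moreover have "scaleL c (r \<mu>) \<in> L.span (r ` D)"
      using \<mu> by (intro L.span_scale L.span_base imageI)
    ultimately have "(mon a \<gamma> *s g - scaleL c (r \<mu>)) + scaleL c (r \<mu>) \<in> L.span (r ` D)"
      by (rule L.span_add)
    then show ?case by simp
  qed
  have "multiples_span G {\<mu>. ldeg \<mu> = q} \<subseteq> L.span (r ` D)"
    unfolding multiples_span_def
  proof (rule L.span_minimal)
    show "{mon a \<epsilon> *s k |\<epsilon> k. k \<in> G \<and> shift \<epsilon> (lm k) \<in> {\<mu>. ldeg \<mu> = q}} \<subseteq> L.span (r ` D)"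
      using span[OF _ refl] by blast
  qed (rule L.subspace_span)
  \<comment> \<open>The chosen multiples have pairwise distinct leading monomials, so
    \<open>f\<close> inherits its leading monomial from one of them.\<close>
  then have "lm f \<in> lm ` (r ` D)"
    using f lm_r by (intro lm_span_distinct) (auto simp: inj_on_def)
  then have "lm f \<in> D" using lm_r by auto
  then show ?thesis by (auto simp: D_def mon_dvd_iff)
qed

section \<open>Homogeneous elements of a generated submodule\<close>

lemma multiples_span_subset: "multiples_span G M \<subseteq> left_submodule_generated G"
  unfolding multiples_span_def
proof (rule L.span_minimal)
  show "L.subspace (left_submodule_generated G)"
    by (auto simp: L.subspace_def scaleL_eq intro: left_submodule_generated_zero
        left_submodule_generated_add left_submodule_generated_mult)
qed (auto intro: left_submodule_generated_mult left_submodule_generated_base)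

lemma left_submodule_generated_subset_span: "left_submodule_generated G \<subseteq> multiples_span G UNIV"
proof -
  have "(\<Sum>g\<in>F. c g *s g) \<in> multiples_span G UNIV" if "F \<subseteq> G" for F c
    unfolding multiples_span_def
  proof (rule L.span_sum)
    fix g assume "g \<in> F"
    then show "c g *s g \<in> L.span {mon a \<epsilon> *s k |\<epsilon> k. k \<in> G \<and> shift \<epsilon> (lm k) \<in> UNIV}"
      by (subst mult_mon_expand, intro L.span_sum L.span_scale L.span_base) (use that in blast)
  qed
  then show ?thesis unfolding left_submodule_generated_def by blast
qed

text \<open>Each spanning multiple is homogeneous, so passing to degree \<open>q\<close> either
  keeps it whole or discards it.\<close>

lemma homogeneous_component:
  assumes "v \<in> multiples_span G UNIV" and G: "\<And>g. g \<in> G \<Longrightarrow> g \<noteq> 0 \<and> homogeneous g"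
  shows "\<exists>w \<in> multiples_span G {\<mu>. ldeg \<mu> = q}.
    \<forall>\<mu>. coeffL w \<mu> = (if ldeg \<mu> = q then coeffL v \<mu> else 0)"
  using assms(1) unfolding multiples_span_def[of G UNIV]
proof (induction rule: L.span_induct_alt)
  case base
  show ?case by (rule bexI[OF _ multiples_span_zero]) (simp add: coeffL_zero)
next
  case (step c x y)
  then obtain w where w: "w \<in> multiples_span G {\<mu>. ldeg \<mu> = q}"
    "\<And>\<mu>. coeffL w \<mu> = (if ldeg \<mu> = q then coeffL y \<mu> else 0)" by blast
  obtain \<epsilon> k where k: "x = mon a \<epsilon> *s k" "k \<in> G" using step by blast
  have deg: "ldeg \<mu> = ldeg (shift \<epsilon> (lm k))" if "coeffL x \<mu> \<noteq> 0" for \<mu>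
    using coeffL_homogeneous_le[OF lm_mon_mult(2) homogeneous_mon_mult that[unfolded k(1)]]
      lm_mon_mult(1)[of k \<epsilon>] G[OF k(2)] by (auto simp: below_def)
  show ?case
  proof (cases "ldeg (shift \<epsilon> (lm k)) = q")
    case True
    then have "scaleL c x + w \<in> multiples_span G {\<mu>. ldeg \<mu> = q}"
      unfolding k(1) by (intro multiples_span_add multiples_span_scale multiples_span_base k(2) w(1)) simp
    then show ?thesis
      by (rule bexI[rotated]) (use deg True w(2) in \<open>fastforce simp: coeffL_add coeffL_scaleL\<close>)
  next
    case False
    show ?thesis
      by (rule bexI[OF _ w(1)]) (use deg False w(2) in \<open>fastforce simp: coeffL_add coeffL_scaleL\<close>)
  qed
qed

lemma homogeneous_in_left_submodule_generated:
  assumes "f \<in> left_submodule_generated G" "\<And>g. g \<in> G \<Longrightarrow> g \<noteq> 0 \<and> homogeneous g" "homogeneous f"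
  shows "f \<in> multiples_span G {\<mu>. ldeg \<mu> = dgr f}"
proof -
  obtain w where w: "w \<in> multiples_span G {\<mu>. ldeg \<mu> = dgr f}"
    "\<And>\<mu>. coeffL w \<mu> = (if ldeg \<mu> = dgr f then coeffL f \<mu> else 0)"
    using homogeneous_component[OF _ assms(2), where q = "dgr f"] left_submodule_generated_subset_span assms(1)
    by blast
  have "w = f" by (rule coeffL_eqI) (use w(2) homogeneous_coeffL[OF assms(3)] in auto)
  with w(1) show ?thesis by simp
qed

text \<open>Positive weights bound every single exponent by the total degree, and there are finitely
  many components.\<close>

lemma finite_bounded_ldeg: "finite {\<mu>. ldeg \<mu> \<le> d}"
proof (rule finite_subset)
  show "finite ({\<alpha> :: 'n expo. \<forall>i. (i \<in> UNIV \<longrightarrow> \<alpha> i \<in> {..d}) \<and> (i \<notin> UNIV \<longrightarrow> \<alpha> i = 0)} \<times> (UNIV :: 's set))"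
    by (intro finite_cartesian_product finite_set_of_finite_funs) auto
  have "\<alpha> i \<le> d" if "wdeg m \<alpha> \<le> d" for \<alpha> i
  proof -
    have "\<alpha> i \<le> m i * \<alpha> i" using weights_pos[of i] by simp
    also have "\<dots> \<le> wdeg m \<alpha>" unfolding wdeg_def by (rule member_le_sum) auto
    finally show ?thesis using that by simp
  qed
  then show "{\<mu>. ldeg \<mu> \<le> d} \<subseteq>
      {\<alpha>. \<forall>i. (i \<in> UNIV \<longrightarrow> \<alpha> i \<in> {..d}) \<and> (i \<notin> UNIV \<longrightarrow> \<alpha> i = 0)} \<times> UNIV"
    by (fastforce simp: ldeg_def)
qed

section \<open>The algorithm\<close>

text \<open>A representation is recorded instead of a zero remainder, because it persists when
  \<open>G\<close> grows and also covers the case where the remainder itself was added to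
  \<open>G\<close>.\<close>

definition pair_resolved :: "('a ^ 's) list \<Rightarrow> nat \<Rightarrow> nat \<Rightarrow> bool" where
  "pair_resolved G i j \<longleftrightarrow>
     spoly (G ! i) (G ! j) \<in> multiples_span (set G) (below (lcm_mon (G ! i) (G ! j)))"

text \<open>Here \<open>S\<close> and \<open>W\<close> are all pending pairs and inputs, including those of the current pass.\<close>

definition basis_invariant ::
    "('a ^ 's) set \<Rightarrow> nat \<Rightarrow> (nat \<times> nat) set \<Rightarrow> ('a ^ 's) set \<Rightarrow> ('a ^ 's) list \<Rightarrow> bool" where
  "basis_invariant U n0 S W G \<longleftrightarrow>
     finite S \<and> W \<subseteq> U \<and> sorted (map dgr G) \<and>
     (\<forall>g\<in>set G. g \<noteq> 0 \<and> homogeneous g \<and> dgr g \<le> n0 \<and> g \<in> left_submodule_generated U) \<and>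
     (\<forall>i j. (i, j) \<in> S \<longrightarrow> i < length G \<and> j < length G \<and> snd (lm (G ! i)) = snd (lm (G ! j)) \<and>
        pair_deg G (i, j) \<le> n0) \<and>
     (\<forall>i j. i < j \<and> j < length G \<and> snd (lm (G ! i)) = snd (lm (G ! j)) \<and>
        pair_deg G (i, j) \<le> n0 \<longrightarrow> (i, j) \<in> S \<or> pair_resolved G i j) \<and>
     (\<forall>u\<in>U - W. u \<in> left_submodule_generated (set G))"

text \<open>Pending degrees are never below those in \<open>G\<close>, which keeps the output
  sorted. The last condition at \<open>Head\<close> makes the next minimum range over a nonempty set
  and stay within \<open>n0\<close>. In \<open>Body\<close>, \<open>\<nu>\<close> is the degree of
  the current pass.\<close>

fun state_invariant :: "('a ^ 's) set \<Rightarrow> nat \<Rightarrow> ('a ^ 's) state \<Rightarrow> bool" where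
  "state_invariant U n0 (Head S W G) \<longleftrightarrow>
     basis_invariant U n0 S W G \<and>
     (\<forall>g\<in>set G. (\<forall>p\<in>S. dgr g \<le> pair_deg G p) \<and> (\<forall>w\<in>W. dgr g \<le> dgr w)) \<and>
     (S \<noteq> {} \<or> (\<exists>w\<in>W. dgr w \<le> n0))"
| "state_invariant U n0 (Body S W S' W' G) \<longleftrightarrow>
     basis_invariant U n0 (S \<union> S') (W \<union> W') G \<and> S \<inter> S' = {} \<and> W \<inter> W' = {} \<and>
     (\<exists>\<nu>\<le>n0. (\<forall>g\<in>set G. dgr g \<le> \<nu>) \<and> (\<forall>p\<in>S'. pair_deg G p = \<nu>) \<and> (\<forall>w\<in>W'. dgr w = \<nu>) \<and>
        (\<forall>p\<in>S. \<nu> \<le> pair_deg G p) \<and> (\<forall>w\<in>W. \<nu> \<le> dgr w))"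
| "state_invariant U n0 (Done G) \<longleftrightarrow> (\<exists>W. basis_invariant U n0 {} W G \<and> (\<forall>w\<in>W. n0 < dgr w))"

lemma pair_deg_append:
  "i < length G \<Longrightarrow> j < length G \<Longrightarrow> pair_deg (G @ [\<eta>]) (i, j) = pair_deg G (i, j)"
  by (simp add: pair_deg_def nth_append)

lemma basis_invariant_resolve:
  "basis_invariant U n0 S W G \<Longrightarrow> pair_resolved G i j \<Longrightarrow> basis_invariant U n0 (S - {(i, j)}) W G"
  unfolding basis_invariant_def by blast

lemma basis_invariant_input:
  "basis_invariant U n0 S W G \<Longrightarrow> u \<in> left_submodule_generated (set G) \<Longrightarrow>
    basis_invariant U n0 S (W - {u}) G"
  unfolding basis_invariant_def by blast

text \<open>Pairs of old elements keep their degrees and representations. Every relevant pair with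
  the new element is put into \<open>new_pairs\<close>, and the maximality of its degree preserves
  sortedness.\<close>

lemma basis_invariant_append:
  assumes inv: "basis_invariant U n0 S W G"
    and \<eta>: "\<eta> \<noteq> 0" "homogeneous \<eta>" "dgr \<eta> \<le> n0" "\<eta> \<in> left_submodule_generated U"
    and max: "\<forall>g\<in>set G. dgr g \<le> dgr \<eta>"
  shows "basis_invariant U n0 (S \<union> new_pairs n0 G \<eta>) W (G @ [\<eta>])"
  unfolding basis_invariant_def
proof (intro conjI allI impI)
  note inv' = inv[unfolded basis_invariant_def]
  have "new_pairs n0 G \<eta> \<subseteq> {..<length G} \<times> {length G}" by (auto simp: new_pairs_def)
  then have "finite (new_pairs n0 G \<eta>)" by (rule finite_subset) simp
  then show "finite (S \<union> new_pairs n0 G \<eta>)" using inv' by blast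
  show "W \<subseteq> U" using inv' by blast
  show "sorted (map dgr (G @ [\<eta>]))" using inv' max by (simp add: sorted_append)
  show "\<forall>g\<in>set (G @ [\<eta>]). g \<noteq> 0 \<and> homogeneous g \<and> dgr g \<le> n0 \<and> g \<in> left_submodule_generated U"
    using inv' \<eta> by auto
  show "\<forall>u\<in>U - W. u \<in> left_submodule_generated (set (G @ [\<eta>]))"
  proof -
    have "left_submodule_generated (set G) \<subseteq> left_submodule_generated (set (G @ [\<eta>]))"
      by (rule left_submodule_generated_mono) auto
    then show ?thesis using inv' by blast
  qed
next
  fix i j
  note inv' = inv[unfolded basis_invariant_def]
  have S: "i < length G \<and> j < length G \<and> snd (lm (G ! i)) = snd (lm (G ! j)) \<and> pair_deg G (i, j) \<le> n0"
    if "(i, j) \<in> S" using inv' that by blast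
  assume "(i, j) \<in> S \<union> new_pairs n0 G \<eta>"
  then have "i < length (G @ [\<eta>]) \<and> j < length (G @ [\<eta>]) \<and>
      snd (lm ((G @ [\<eta>]) ! i)) = snd (lm ((G @ [\<eta>]) ! j)) \<and> pair_deg (G @ [\<eta>]) (i, j) \<le> n0"
    using S by (auto simp: new_pairs_def pair_deg_def nth_append)
  then show "i < length (G @ [\<eta>])" "j < length (G @ [\<eta>])"
      "snd (lm ((G @ [\<eta>]) ! i)) = snd (lm ((G @ [\<eta>]) ! j))" "pair_deg (G @ [\<eta>]) (i, j) \<le> n0"
    by auto
next
  fix i j
  note inv' = inv[unfolded basis_invariant_def]
  assume ij: "i < j \<and> j < length (G @ [\<eta>]) \<and> snd (lm ((G @ [\<eta>]) ! i)) = snd (lm ((G @ [\<eta>]) ! j)) \<and>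
      pair_deg (G @ [\<eta>]) (i, j) \<le> n0"
  show "(i, j) \<in> S \<union> new_pairs n0 G \<eta> \<or> pair_resolved (G @ [\<eta>]) i j"
  proof (cases "j < length G")
    case True
    then have i: "i < length G" using ij by simp
    have "i < j \<and> j < length G \<and> snd (lm (G ! i)) = snd (lm (G ! j)) \<and> pair_deg G (i, j) \<le> n0"
      using ij i True pair_deg_append[of i G j] by (simp add: nth_append)
    then have "(i, j) \<in> S \<or> pair_resolved G i j" using inv' by blast
    moreover have "pair_resolved (G @ [\<eta>]) i j" if "pair_resolved G i j"
    proof -
      have "multiples_span (set G) M \<subseteq> multiples_span (set (G @ [\<eta>])) M" for M
        by (rule multiples_span_mono) auto
      then show ?thesis using that True ij unfolding pair_resolved_def by (simp add: nth_append) blast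
    qed
    ultimately show ?thesis by blast
  next
    case False
    then have "j = length G" using ij by simp
    then show ?thesis using ij by (auto simp: new_pairs_def pair_deg_def nth_append)
  qed
qed

text \<open>The support of the remainder stays in \<open>M\<close>, which fixes its degree, and
  avoids all multiples of old leading monomials, which makes its own leading monomial new. Adding
  the remainder to the generators represents the dividend as
  \<open>(\<xi> - \<eta>) + \<eta>\<close>.\<close>

lemma remainder_new_element:
  assumes rem: "remainder (set G) \<xi> \<eta>" and inv: "basis_invariant U n0 S W G"
    and M: "\<And>\<mu>. \<mu> \<in> M \<Longrightarrow> below \<mu> \<subseteq> M" "\<And>\<mu>. \<mu> \<in> M \<Longrightarrow> ldeg \<mu> = \<nu>"
    and \<xi>: "\<And>\<mu>. coeffL \<xi> \<mu> \<noteq> 0 \<Longrightarrow> \<mu> \<in> M" "\<xi> \<in> left_submodule_generated U"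
    and \<eta>: "\<eta> \<noteq> 0"
  shows "homogeneous \<eta>" "dgr \<eta> = \<nu>" "\<eta> \<in> left_submodule_generated U"
    "lm \<eta> \<notin> lm ` set G" "ldeg (lm \<eta>) = \<nu>" "\<xi> \<in> multiples_span (set (G @ [\<eta>])) M"
proof -
  have G: "\<And>p. p \<in> set G \<Longrightarrow> p \<noteq> 0 \<and> homogeneous p"
    and GU: "set G \<subseteq> left_submodule_generated U"
    using inv unfolding basis_invariant_def by blast+
  have rep: "\<xi> - \<eta> \<in> multiples_span (set G) M"
    "\<And>\<mu>. coeffL \<eta> \<mu> \<noteq> 0 \<Longrightarrow> \<mu> \<in> M \<and> (\<forall>p\<in>set G. \<not> mon_dvd (lm p) \<mu>)"
    using remainder_representation[OF rem G M(1) \<xi>(1)] by blast+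
  have \<eta>M: "lm \<eta> \<in> M" and nd: "\<forall>p\<in>set G. \<not> mon_dvd (lm p) (lm \<eta>)"
    using rep(2)[OF lc_nonzero[OF \<eta>]] by auto
  have "\<eta> \<in> hom_part \<nu>" using rep(2) M(2) unfolding hom_part_iff by blast
  then show "homogeneous \<eta>" "dgr \<eta> = \<nu>"
    using dgr_eqI[OF \<eta>] by (auto simp: homogeneous_def)
  show "ldeg (lm \<eta>) = \<nu>" using M(2) \<eta>M .
  have d: "\<xi> - \<eta> \<in> multiples_span (set G) M" using rep(1) by blast
  then have "\<xi> - \<eta> \<in> left_submodule_generated U"
    using multiples_span_subset left_submodule_generated_subset[OF GU] by blast
  from left_submodule_generated_diff[OF \<xi>(2) this] show "\<eta> \<in> left_submodule_generated U" by simp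
  have "mon_dvd \<mu> \<mu>" for \<mu> unfolding mon_dvd_iff by (rule exI[of _ "\<lambda>_. 0"]) (simp add: shift_zero)
  then show "lm \<eta> \<notin> lm ` set G" using nd by (metis imageE)
  have "\<xi> - \<eta> \<in> multiples_span (set (G @ [\<eta>])) M"
    using d multiples_span_mono[of "set G" "set (G @ [\<eta>])" M M] by auto
  from multiples_span_add[OF this multiples_span_self[of \<eta>]] show "\<xi> \<in> multiples_span (set (G @ [\<eta>])) M"
    using \<eta>M by simp
qed

section \<open>Termination measure\<close>

definition free_mons :: "nat \<Rightarrow> ('a ^ 's) list \<Rightarrow> ('n, 's) lmon set" where
  "free_mons n0 G = {\<mu>. ldeg \<mu> \<le> n0} - lm ` set G"

text \<open>The new leading monomial leaves the finite set of monomials that are still free. This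
  pays for the pairs that a new element creates.\<close>

lemma card_free_mons_append:
  assumes "lm \<eta> \<notin> lm ` set G" "ldeg (lm \<eta>) \<le> n0"
  shows "card (free_mons n0 (G @ [\<eta>])) < card (free_mons n0 G)"
proof (rule psubset_card_mono)
  show "finite (free_mons n0 G)" unfolding free_mons_def using finite_bounded_ldeg by blast
  show "free_mons n0 (G @ [\<eta>]) \<subset> free_mons n0 G" using assms by (auto simp: free_mons_def)
qed

text \<open>The last component orders the program points between two changes of the other two:
  an exhausted pass, the head of the next pass, a pass with work left.\<close>

fun state_measure :: "nat \<Rightarrow> ('a ^ 's) state \<Rightarrow> nat \<times> nat \<times> nat" where
  "state_measure n0 (Head S W G) = (card (free_mons n0 G), card S + card W, 1)"
| "state_measure n0 (Body S W S' W' G) =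
    (card (free_mons n0 G), card S + card S' + (card W + card W'), if S' = {} \<and> W' = {} then 2 else 0)"
| "state_measure n0 (Done G) = (card (free_mons n0 G), 0, 0)"

abbreviation lex3 :: "((nat \<times> nat \<times> nat) \<times> (nat \<times> nat \<times> nat)) set" where
  "lex3 \<equiv> less_than <*lex*> less_than <*lex*> less_than"

section \<open>Preservation of the invariant and decrease of the measure\<close>

lemma basis_invariant_finite:
  "basis_invariant U n0 S W G \<Longrightarrow> finite U \<Longrightarrow> finite S \<and> finite W"
  unfolding basis_invariant_def by (auto intro: finite_subset)

text \<open>The lcm is a multiple of the leading monomial of \<open>\<eta>\<close>, so a pass never
  creates a pair of degree lower than its own.\<close>

lemma new_pairs_deg:
  assumes "\<eta> \<noteq> 0" "homogeneous \<eta>" "p \<in> new_pairs n0 G \<eta>"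
  shows "dgr \<eta> \<le> pair_deg (G @ [\<eta>]) p"
proof -
  obtain i where i: "p = (i, length G)" "i < length G" "snd (lm (G ! i)) = snd (lm \<eta>)"
    using assms(3) by (auto simp: new_pairs_def)
  have "pair_deg (G @ [\<eta>]) p = ldeg (lcm_mon \<eta> (G ! i))"
    using i lcm_mon_commute[OF i(3)] by (simp add: pair_deg_def nth_append ldeg_lcm_mon[symmetric])
  also have "\<dots> \<ge> ldeg (lm \<eta>)"
    by (subst shift_lcm_mon[symmetric]) (simp add: ldeg_shift)
  finally show ?thesis using ldeg_lm[OF assms(1,2)] by simp
qed

text \<open>New pairs have second index \<open>length G\<close>, whereas pending pairs only use
  indices of elements already present.\<close>

lemma new_pairs_disjoint:
  "basis_invariant U n0 S W G \<Longrightarrow> S' \<subseteq> S \<Longrightarrow> new_pairs n0 G \<eta> \<inter> S' = {}"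
  unfolding basis_invariant_def new_pairs_def by fastforce

text \<open>The common part of the two steps that extend the basis, before the processed pair or
  input is removed from the pending ones.\<close>

lemma body_append:
  assumes inv: "basis_invariant U n0 (S \<union> S') (W \<union> W') G" "S \<inter> S' = {}"
    and deg: "\<nu> \<le> n0" "\<forall>g\<in>set G. dgr g \<le> \<nu>" "\<forall>p\<in>S'. pair_deg G p = \<nu>" "\<forall>p\<in>S. \<nu> \<le> pair_deg G p"
    and \<eta>: "\<eta> \<noteq> 0" "homogeneous \<eta>" "dgr \<eta> = \<nu>" "\<eta> \<in> left_submodule_generated U"
  shows "basis_invariant U n0 ((S \<union> new_pairs n0 G \<eta>) \<union> S') (W \<union> W') (G @ [\<eta>])"
    "(S \<union> new_pairs n0 G \<eta>) \<inter> S' = {}"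
    "\<forall>g\<in>set (G @ [\<eta>]). dgr g \<le> \<nu>"
    "\<forall>p\<in>S'. pair_deg (G @ [\<eta>]) p = \<nu>"
    "\<forall>p\<in>S \<union> new_pairs n0 G \<eta>. \<nu> \<le> pair_deg (G @ [\<eta>]) p"
proof -
  show "basis_invariant U n0 ((S \<union> new_pairs n0 G \<eta>) \<union> S') (W \<union> W') (G @ [\<eta>])"
    using basis_invariant_append[OF inv(1) \<eta>(1,2) _ \<eta>(4)] deg(1,2) \<eta>(3) by (simp add: Un_ac)
  show "(S \<union> new_pairs n0 G \<eta>) \<inter> S' = {}"
    using inv(2) new_pairs_disjoint[OF inv(1), of S' \<eta>] by blast
  show "\<forall>g\<in>set (G @ [\<eta>]). dgr g \<le> \<nu>" using deg(2) \<eta>(3) by simp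
  have old: "pair_deg (G @ [\<eta>]) p = pair_deg G p" if "p \<in> S \<union> S'" for p
  proof -
    have "\<forall>i j. (i, j) \<in> S \<union> S' \<longrightarrow> i < length G \<and> j < length G"
      using inv(1) unfolding basis_invariant_def by blast
    then have "fst p < length G" "snd p < length G" using that by (metis prod.collapse)+
    then show ?thesis using pair_deg_append[of "fst p" G "snd p" \<eta>] by simp
  qed
  then show "\<forall>p\<in>S'. pair_deg (G @ [\<eta>]) p = \<nu>" using deg(3) by simp
  show "\<forall>p\<in>S \<union> new_pairs n0 G \<eta>. \<nu> \<le> pair_deg (G @ [\<eta>]) p"
    using old deg(4) new_pairs_deg[OF \<eta>(1,2)] \<eta>(3) by auto
qed

lemma spoly_in_left_submodule:
  assumes "g \<in> left_submodule_generated U" "h \<in> left_submodule_generated U"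
  shows "spoly g h \<in> left_submodule_generated U"
  unfolding spoly_def lcm_multiple_def scaleL_eq
  by (intro left_submodule_generated_diff left_submodule_generated_mult assms)

lemma spoly_support:
  assumes "basis_invariant U n0 S W G" "(i, j) \<in> S"
  shows "coeffL (spoly (G ! i) (G ! j)) \<mu> \<noteq> 0 \<Longrightarrow> \<mu> \<in> below (lcm_mon (G ! i) (G ! j))"
    and "\<mu> \<in> below (lcm_mon (G ! i) (G ! j)) \<Longrightarrow> ldeg \<mu> = pair_deg G (i, j)"
    and "spoly (G ! i) (G ! j) \<in> left_submodule_generated U"
proof -
  have ij: "i < length G" "j < length G" "snd (lm (G ! i)) = snd (lm (G ! j))"
    using assms unfolding basis_invariant_def by blast+
  then have G: "G ! i \<noteq> 0" "homogeneous (G ! i)" "G ! i \<in> left_submodule_generated U"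
    "G ! j \<noteq> 0" "homogeneous (G ! j)" "G ! j \<in> left_submodule_generated U"
    using assms(1) nth_mem unfolding basis_invariant_def by blast+
  show "coeffL (spoly (G ! i) (G ! j)) \<mu> \<noteq> 0 \<Longrightarrow> \<mu> \<in> below (lcm_mon (G ! i) (G ! j))"
    by (rule coeffL_spoly[OF G(1,2,4,5) ij(3)])
  show "\<mu> \<in> below (lcm_mon (G ! i) (G ! j)) \<Longrightarrow> ldeg \<mu> = pair_deg G (i, j)"
    by (simp add: below_def ldeg_lcm_mon pair_deg_def)
  show "spoly (G ! i) (G ! j) \<in> left_submodule_generated U"
    by (rule spoly_in_left_submodule[OF G(3,6)])
qed

lemma remainder_zero_span:
  assumes "remainder (set G) \<xi> 0" "basis_invariant U n0 S W G"
    "\<And>\<mu>. \<mu> \<in> M \<Longrightarrow> below \<mu> \<subseteq> M" "\<And>\<mu>. coeffL \<xi> \<mu> \<noteq> 0 \<Longrightarrow> \<mu> \<in> M"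
  shows "\<xi> \<in> multiples_span (set G) M"
proof -
  have "\<And>p. p \<in> set G \<Longrightarrow> p \<noteq> 0 \<and> homogeneous p"
    using assms(2) unfolding basis_invariant_def by blast
  from remainder_representation(1)[OF assms(1) this assms(3,4)] show ?thesis by simp
qed

lemma below_closed: "\<mu> \<in> below \<nu> \<Longrightarrow> below \<mu> \<subseteq> below \<nu>"
  using below_trans by blast

lemma step_invariant:
  assumes U: "finite U" "\<forall>u\<in>U. u \<noteq> 0 \<and> homogeneous u"
    and "step n0 s s'" "state_invariant U n0 s"
  shows "state_invariant U n0 s' \<and> (state_measure n0 s', state_measure n0 s) \<in> lex3"
  using assms(3)
proof cases
  case (begin_pass \<nu> W G S S' W')
  note inv = assms(4)[unfolded begin_pass(1) state_invariant.simps]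
  have fin: "finite S" "finite W" using basis_invariant_finite[OF _ U(1)] inv by blast+
  let ?D = "dgr ` W \<union> pair_deg G ` S"
  have D: "finite ?D" "?D \<noteq> {}" using fin inv by auto
  have \<nu>: "\<nu> \<in> ?D" "\<And>d. d \<in> ?D \<Longrightarrow> \<nu> \<le> d"
    using Min_in[OF D] Min_le[OF D(1)] begin_pass(3) by auto
  \<comment> \<open>Pending pairs have degree at most \<open>n0\<close> by the invariant; without
    pending pairs, some pending input has degree at most \<open>n0\<close>.\<close>
  have "\<nu> \<le> n0"
  proof (cases "S = {}")
    case True
    then obtain w where "w \<in> W" "dgr w \<le> n0" using inv by blast
    then show ?thesis using \<nu>(2)[of "dgr w"] by auto
  next
    case False
    then obtain p where p: "p \<in> S" by blast
    then have "pair_deg G p \<le> n0"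
      using inv unfolding basis_invariant_def by (metis prod.collapse)
    then show ?thesis using \<nu>(2)[of "pair_deg G p"] p by auto
  qed
  moreover have "\<forall>g\<in>set G. dgr g \<le> \<nu>" using inv \<nu>(1) by auto
  moreover have "S - S' \<union> S' = S" "W - W' \<union> W' = W" using begin_pass(4,5) by auto
  ultimately have "state_invariant U n0 s'"
    unfolding begin_pass(2) state_invariant.simps using inv \<nu>(2) begin_pass(4,5) by auto
  moreover have "card (S - S') + card S' = card S"
    using begin_pass(4) fin(1) by (simp add: card_Diff_subset card_mono)
  moreover have "card (W - W') + card W' = card W"
    using begin_pass(5) fin(2) by (simp add: card_Diff_subset card_mono)
  \<comment> \<open>The minimum is attained, so the pass has work to do and the last component of
    the measure drops from 1 to 0.\<close>
  moreover have "\<not> (S' = {} \<and> W' = {})" using \<nu>(1) begin_pass(4,5) by auto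
  ultimately show ?thesis unfolding begin_pass(1,2) by auto
next
  case (spoly_zero i j S' G S W W')
  note inv = assms(4)[unfolded spoly_zero(1) state_invariant.simps]
  have inv0: "basis_invariant U n0 (S \<union> S') (W \<union> W') G" using inv by blast
  have p: "(i, j) \<in> S \<union> S'" using spoly_zero by blast
  have "pair_resolved G i j"
    unfolding pair_resolved_def
    by (rule remainder_zero_span[OF spoly_zero(4) inv0 below_closed spoly_support(1)[OF inv0 p]])
  then have "basis_invariant U n0 (S \<union> S' - {(i, j)}) (W \<union> W') G"
    by (rule basis_invariant_resolve[OF inv0])
  moreover have "S \<union> S' - {(i, j)} = S \<union> (S' - {(i, j)})" using inv spoly_zero(3) by blast
  ultimately have "state_invariant U n0 s'"
    unfolding spoly_zero(2) state_invariant.simps using inv by auto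
  moreover have "card (S' - {(i, j)}) < card S'"
    using basis_invariant_finite[OF inv0 U(1)] spoly_zero(3) by (intro card_Diff1_less) auto
  ultimately show ?thesis unfolding spoly_zero(1,2) by auto
next
  case (spoly_nonzero i j S' G \<eta> S W W')
  note inv = assms(4)[unfolded spoly_nonzero(1) state_invariant.simps]
  have inv0: "basis_invariant U n0 (S \<union> S') (W \<union> W') G" using inv by blast
  obtain \<nu> where \<nu>: "\<nu> \<le> n0" "\<forall>g\<in>set G. dgr g \<le> \<nu>" "\<forall>p\<in>S'. pair_deg G p = \<nu>" "\<forall>w\<in>W'. dgr w = \<nu>"
    "\<forall>p\<in>S. \<nu> \<le> pair_deg G p" "\<forall>w\<in>W. \<nu> \<le> dgr w" using inv by blast
  have p: "(i, j) \<in> S \<union> S'" using spoly_nonzero by blast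
  have deg: "pair_deg G (i, j) = \<nu>" using \<nu>(3) spoly_nonzero(3) by blast
  note \<eta> = remainder_new_element[OF spoly_nonzero(4) inv0 below_closed
      spoly_support(2)[OF inv0 p] spoly_support(1)[OF inv0 p] spoly_support(3)[OF inv0 p]
      spoly_nonzero(5), unfolded deg]
  note app = body_append[OF inv0 _ \<nu>(1,2,3,5) spoly_nonzero(5) \<eta>(1,2,3)]
  have ij: "i < length G" "j < length G" using inv0 p unfolding basis_invariant_def by blast+
  have "pair_resolved (G @ [\<eta>]) i j"
    unfolding pair_resolved_def using \<eta>(6) ij by (simp add: nth_append)
  then have "basis_invariant U n0 (S \<union> new_pairs n0 G \<eta> \<union> S' - {(i, j)}) (W \<union> W') (G @ [\<eta>])"
    using basis_invariant_resolve app(1) inv by blast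
  moreover have disj: "(S \<union> new_pairs n0 G \<eta>) \<inter> S' = {}" using app(2) inv by blast
  then have "S \<union> new_pairs n0 G \<eta> \<union> S' - {(i, j)} = (S \<union> new_pairs n0 G \<eta>) \<union> (S' - {(i, j)})"
    using spoly_nonzero(3) by blast
  ultimately have "state_invariant U n0 s'"
    unfolding spoly_nonzero(2) state_invariant.simps
    using inv disj \<nu>(1,4,6) app(3-5) by (intro conjI exI[of _ \<nu>]) auto
  \<comment> \<open>The first component drops, so the growth of the set of pending pairs does no
    harm.\<close>
  moreover have "card (free_mons n0 (G @ [\<eta>])) < card (free_mons n0 G)"
    using card_free_mons_append \<eta>(4,5) \<nu>(1) by blast
  ultimately show ?thesis unfolding spoly_nonzero(1,2) by auto
next
  case (input_zero \<xi> W' G S W)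
  note inv = assms(4)[unfolded input_zero(1) state_invariant.simps]
  have inv0: "basis_invariant U n0 (S \<union> {}) (W \<union> W') G" using inv by blast
  \<comment> \<open>For a processed input the invariant asks only for membership in the generated
    submodule, so the leading monomials of the multiples are left unrestricted.\<close>
  have "\<xi> \<in> multiples_span (set G) UNIV"
    by (rule remainder_zero_span[OF input_zero(4) inv0]) auto
  then have "\<xi> \<in> left_submodule_generated (set G)" using multiples_span_subset by blast
  then have "basis_invariant U n0 (S \<union> {}) (W \<union> W' - {\<xi>}) G"
    by (rule basis_invariant_input[OF inv0])
  moreover have "W \<union> W' - {\<xi>} = W \<union> (W' - {\<xi>})" using inv input_zero(3) by blast
  ultimately have "state_invariant U n0 s'"
    unfolding input_zero(2) state_invariant.simps using inv by auto
  moreover have "card (W' - {\<xi>}) < card W'"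
    using basis_invariant_finite[OF inv0 U(1)] input_zero(3) by (intro card_Diff1_less) auto
  ultimately show ?thesis unfolding input_zero(1,2) by auto
next
  case (input_nonzero \<xi> W' G \<eta> S W)
  note inv = assms(4)[unfolded input_nonzero(1) state_invariant.simps]
  have inv0: "basis_invariant U n0 (S \<union> {}) (W \<union> W') G" using inv by blast
  obtain \<nu> where \<nu>: "\<nu> \<le> n0" "\<forall>g\<in>set G. dgr g \<le> \<nu>" "\<forall>w\<in>W'. dgr w = \<nu>"
    "\<forall>p\<in>S. \<nu> \<le> pair_deg G p" "\<forall>w\<in>W. \<nu> \<le> dgr w" using inv by blast
  have \<xi>: "\<xi> \<in> U" using inv0 input_nonzero(3) unfolding basis_invariant_def by blast
  have supp: "\<mu> \<in> {\<mu>. ldeg \<mu> = \<nu>}" if "coeffL \<xi> \<mu> \<noteq> 0" for \<mu>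
    using homogeneous_coeffL[OF _ that] U(2) \<xi> \<nu>(3) input_nonzero(3) by auto
  have closed: "below \<mu> \<subseteq> {\<mu>. ldeg \<mu> = \<nu>}" if "\<mu> \<in> {\<mu>. ldeg \<mu> = \<nu>}" for \<mu>
    using that by (auto simp: below_def)
  have deg: "ldeg \<mu> = \<nu>" if "\<mu> \<in> {\<mu>. ldeg \<mu> = \<nu>}" for \<mu>
    using that by blast
  note \<eta> = remainder_new_element[OF input_nonzero(4) inv0 closed deg supp
      left_submodule_generated_base[OF \<xi>] input_nonzero(5)]
  have empty: "S \<inter> {} = {}" "\<forall>p\<in>{}. pair_deg G p = \<nu>" by blast+
  note app = body_append[OF inv0 empty(1) \<nu>(1,2) empty(2) \<nu>(4) input_nonzero(5) \<eta>(1,2,3)]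
  have "\<xi> \<in> left_submodule_generated (set (G @ [\<eta>]))" using \<eta>(6) multiples_span_subset by blast
  then have "basis_invariant U n0 (S \<union> new_pairs n0 G \<eta> \<union> {}) (W \<union> W' - {\<xi>}) (G @ [\<eta>])"
    using basis_invariant_input app(1) by blast
  moreover have "W \<union> W' - {\<xi>} = W \<union> (W' - {\<xi>})" using inv input_nonzero(3) by blast
  ultimately have "state_invariant U n0 s'"
    unfolding input_nonzero(2) state_invariant.simps
    using inv \<nu>(1,3,5) app(3-5) by (intro conjI exI[of _ \<nu>]) auto
  moreover have "card (free_mons n0 (G @ [\<eta>])) < card (free_mons n0 G)"
    using card_free_mons_append \<eta>(4,5) \<nu>(1) by blast
  ultimately show ?thesis unfolding input_nonzero(1,2) by auto
next
  case (continue S W G)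
  \<comment> \<open>The degree \<open>\<nu>\<close> of the finished pass separates \<open>G\<close>
    from what is pending, and the last component drops from 2 to 1.\<close>
  then show ?thesis using assms(4) by auto (meson order_trans)+
next
  case (stop S W G)
  \<comment> \<open>Inputs of degree above \<open>n0\<close> may remain; \<open>Done\<close> counts
    nothing as pending, and the last component falls from 2 to 0 in any case.\<close>
  then show ?thesis using assms(4) by auto
qed

text \<open>A \<open>Head\<close> can begin a pass. In a \<open>Body\<close> the required remainder
  exists because \<open>G\<close> has no zero element, and the guards of the rules cover every
  case.\<close>

lemma step_progress:
  assumes "state_invariant U n0 s"
  shows "(\<exists>G. s = Done G) \<or> (\<exists>s'. step n0 s s')"
proof (cases s)
  case (Head S W G)
  then show ?thesis using step.begin_pass by blast
next
  case (Body S W S' W' G)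
  have "0 \<notin> set G" using assms unfolding Body by (auto simp: basis_invariant_def)
  then have rem: "\<exists>\<eta>. remainder (set G) \<xi> \<eta>" for \<xi> by (rule ex_remainder)
  consider (pair) i j where "(i, j) \<in> S'" | (input) \<xi> where "S' = {}" "\<xi> \<in> W'"
    | (empty) "S' = {}" "W' = {}" by fast
  then show ?thesis
  proof cases
    case pair
    then show ?thesis
      using rem[of "spoly (G ! i) (G ! j)"] step.spoly_zero step.spoly_nonzero unfolding Body by metis
  next
    case input
    then show ?thesis
      using rem[of \<xi>] step.input_zero step.input_nonzero unfolding Body by metis
  next
    case empty
    then show ?thesis
      using step.continue[of S W n0 G] step.stop[of S W n0 G] unfolding Body by (metis not_less)
  qed
qed simp

text \<open>The generating set demanded by the definition is \<open>G\<close> together with the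
  inputs still pending. These have degree above \<open>n0\<close>, so truncation leaves exactly
  \<open>set G\<close>.\<close>

lemma done_truncated_left_GB:
  assumes inv: "state_invariant U n0 (Done G)" and U: "finite U" "\<forall>u\<in>U. u \<noteq> 0 \<and> homogeneous u"
  shows "truncated_left_GB n0 (set G) (left_submodule_generated U) \<and> sorted (map dgr G)"
proof -
  obtain W where inv0: "basis_invariant U n0 {} W G" and W: "\<forall>w\<in>W. n0 < dgr w"
    using inv by auto
  note inv' = inv0[unfolded basis_invariant_def]
  have G: "g \<noteq> 0" "homogeneous g" "dgr g \<le> n0" "g \<in> left_submodule_generated U" if "g \<in> set G" for g
    using inv' that by blast+
  let ?H = "set G \<union> W"
  have W_U: "W \<subseteq> U" using inv' by blast
  have H: "h \<noteq> 0 \<and> homogeneous h" if "h \<in> ?H" for h using that G U(2) W_U by blast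
  have gen: "left_submodule_generated U = left_submodule_generated ?H"
  proof
    have "U \<subseteq> left_submodule_generated ?H"
    proof
      fix u assume "u \<in> U"
      then show "u \<in> left_submodule_generated ?H"
        using inv' left_submodule_generated_mono[of "set G" ?H] left_submodule_generated_base[of u ?H]
        by blast
    qed
    then show "left_submodule_generated U \<subseteq> left_submodule_generated ?H"
      by (rule left_submodule_generated_subset)
    have "?H \<subseteq> left_submodule_generated U"
      using G(4) W_U left_submodule_generated_base by blast
    then show "left_submodule_generated ?H \<subseteq> left_submodule_generated U"
      by (rule left_submodule_generated_subset)
  qed
  have ordered: "spoly g h \<in> multiples_span (set G) (below (lcm_mon g h))"
    if "i < j" "j < length G" "g = G ! i" "h = G ! j" "snd (lm g) = snd (lm h)" "spoly_deg g h \<le> n0"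
    for g h i j
    using inv' that unfolding pair_resolved_def pair_deg_def by auto
  have pairs: "spoly g h \<in> multiples_span (set G) (below (lcm_mon g h))"
    if gh: "g \<in> set G" "h \<in> set G" "snd (lm g) = snd (lm h)" "spoly_deg g h \<le> n0" for g h
  proof -
    obtain i j where ij: "i < length G" "g = G ! i" "j < length G" "h = G ! j"
      using gh(1,2) by (metis in_set_conv_nth)
    consider "i < j" | "i = j" | "j < i" by linarith
    then show ?thesis
    proof cases
      case 1
      then show ?thesis using ordered ij gh by blast
    next
      case 2
      then show ?thesis using ij by (simp add: spoly_def multiples_span_zero)
    next
      case 3
      \<comment> \<open>The invariant covers pairs with increasing indices; the other order follows
        from the symmetry of the lcm and the antisymmetry of \<open>spoly\<close>.\<close>
      have "spoly_deg h g \<le> n0" using gh(4) lcm_mon_commute[OF gh(3)] by (simp flip: ldeg_lcm_mon)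
      then have "spoly h g \<in> multiples_span (set G) (below (lcm_mon g h))"
        using ordered[OF 3 ij(1,4,2)] gh(3) lcm_mon_commute[OF gh(3)] by simp
      then show ?thesis
        using multiples_span_diff[OF multiples_span_zero] spoly_antisym[of g h] by simp
    qed
  qed
  have GB: "\<exists>g\<in>set G. mon_dvd (lm g) (lm \<xi>)"
    if \<xi>: "\<xi> \<in> left_submodule_generated U" "\<xi> \<noteq> 0" "homogeneous \<xi>" "dgr \<xi> \<le> n0" for \<xi>
  proof (rule truncated_Buchberger_criterion[OF _ pairs _ \<xi>(4,2)])
    show "0 \<notin> set G" using G(1) by blast
    have "\<xi> \<in> multiples_span ?H {\<mu>. ldeg \<mu> = dgr \<xi>}"
      using \<xi>(1,3) H unfolding gen by (intro homogeneous_in_left_submodule_generated)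
    also have "\<dots> \<subseteq> multiples_span (set G) {\<mu>. ldeg \<mu> = dgr \<xi>}"
    proof -
      have "k \<in> set G" if "k \<in> ?H" "ldeg (shift \<epsilon> (lm k)) = dgr \<xi>" for \<epsilon> k
      proof -
        \<comment> \<open>A generator is no larger in degree than its multiples, so a pending input
          cannot contribute in degree \<open>dgr \<xi>\<close>.\<close>
        have "dgr k \<le> n0" using that \<xi>(4) ldeg_lm[of k] H[of k] by (simp add: ldeg_shift)
        then show ?thesis using that(1) W by auto
      qed
      then show ?thesis by (intro multiples_span_subsetI) auto
    qed
    finally show "\<xi> \<in> multiples_span (set G) {\<mu>. ldeg \<mu> = dgr \<xi>}" .
  qed
  have "finite W" using W_U U(1) by (rule finite_subset)
  moreover have "set G = {h \<in> ?H. dgr h \<le> n0}" using G(3) W by auto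
  ultimately have "truncated_left_GB n0 (set G) (left_submodule_generated U)"
    unfolding truncated_left_GB_def using H gen GB by (intro exI[of _ ?H]) auto
  then show ?thesis using inv' by blast
qed

end

text \<open>As the choices are nondeterministic, the claims concern every run. Absence of infinite
  runs and of stuck states other than \<open>Done\<close> shows that each maximal run ends in
  \<open>Done\<close>, so the statement about the output is not vacuous.\<close>

theorem proposition3p5:
  fixes scale :: "'k::field \<Rightarrow> 'a::ring_1 \<Rightarrow> 'a"
    and a :: "'n::{finite,linorder} \<Rightarrow> 'a"
    and prec :: "'n expo \<Rightarrow> 'n expo \<Rightarrow> bool"
    and m :: "'n \<Rightarrow> nat"
    and b :: "'s::finite \<Rightarrow> nat"
    and prece :: "('n, 's) lmon \<Rightarrow> ('n, 's) lmon \<Rightarrow> bool"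
    and U :: "('a ^ 's) list"
    and n0 :: nat
  assumes "graded_free_module scale a prec m prece"
    and "U \<noteq> []"
    and "\<forall>\<xi>\<in>set U. \<xi> \<noteq> 0 \<and> graded_free_module.homogeneous scale a m b \<xi>"
    and "sorted (map (graded_free_module.dgr scale a m b) U)"
    and "0 < n0"
    and "graded_free_module.dgr scale a m b (hd U) \<le> n0"
  shows "(\<forall>P \<xi>. finite P \<and> 0 \<notin> P \<longrightarrow>
           \<not> (\<exists>r. r 0 = (\<xi>, 0) \<and>
                (\<forall>k::nat. graded_free_module.div_step scale a prece P (r k) (r (Suc k)))))
    \<and> \<not> (\<exists>r. r 0 = Head {} (set U) [] \<and>
            (\<forall>k::nat. graded_free_module.step scale a m b prece n0 (r k) (r (Suc k))))
    \<and> (\<forall>s. (graded_free_module.step scale a m b prece n0)\<^sup>*\<^sup>* (Head {} (set U) []) s \<longrightarrow>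
           (\<exists>G. s = Done G) \<or> (\<exists>s'. graded_free_module.step scale a m b prece n0 s s'))
    \<and> (\<forall>G. (graded_free_module.step scale a m b prece n0)\<^sup>*\<^sup>* (Head {} (set U) []) (Done G) \<longrightarrow>
           graded_free_module.truncated_left_GB scale a m b prece n0 (set G)
             (left_submodule_generated (set U)) \<and>
           sorted (map (graded_free_module.dgr scale a m b) G))"
proof -
  interpret graded_free_module scale a prec m b prece by (rule assms(1))
  let ?init = "Head {} (set U) []"
  note U = finite_set[of U] assms(3)
  \<comment> \<open>The bound on the degree of the first input provides a pending input of degree at
    most \<open>n0\<close>, as the invariant demands at \<open>Head\<close>.\<close>
  have init: "state_invariant (set U) n0 ?init"
    using assms(2,6) hd_in_set[of U] by (auto simp: basis_invariant_def)
  have inv: "state_invariant (set U) n0 s" if "(step n0)\<^sup>*\<^sup>* ?init s" for s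
    using that by induction (use init step_invariant[OF U] in auto)
  have "\<not> (\<exists>r. r 0 = ?init \<and> (\<forall>k::nat. step n0 (r k) (r (Suc k))))"
  proof
    assume "\<exists>r. r 0 = ?init \<and> (\<forall>k::nat. step n0 (r k) (r (Suc k)))"
    then obtain r where r: "r 0 = ?init" "\<And>k::nat. step n0 (r k) (r (Suc k))" by blast
    have "state_invariant (set U) n0 (r k)" for k
      by (induction k) (use r init step_invariant[OF U] in auto)
    then have "(state_measure n0 (r (Suc k)), state_measure n0 (r k)) \<in> lex3" for k
      using step_invariant[OF U r(2)] by blast
    then have "\<exists>f. \<forall>k. (f (Suc k), f k) \<in> lex3"
      by (intro exI[of _ "\<lambda>k. state_measure n0 (r k)"]) blast
    moreover have "wf lex3" by (intro wf_lex_prod wf_less_than)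
    ultimately show False unfolding wf_iff_no_infinite_down_chain by blast
  qed
  moreover have "\<forall>P \<xi>. finite P \<and> 0 \<notin> P \<longrightarrow>
      \<not> (\<exists>r. r 0 = (\<xi>, 0) \<and> (\<forall>k::nat. div_step P (r k) (r (Suc k))))"
    using no_infinite_division by blast
  moreover have "\<forall>s. (step n0)\<^sup>*\<^sup>* ?init s \<longrightarrow> (\<exists>G. s = Done G) \<or> (\<exists>s'. step n0 s s')"
    using step_progress[OF inv] by blast
  moreover have "\<forall>G. (step n0)\<^sup>*\<^sup>* ?init (Done G) \<longrightarrow>
      truncated_left_GB n0 (set G) (left_submodule_generated (set U)) \<and> sorted (map dgr G)"
    using done_truncated_left_GB[OF inv U] by blast
  ultimately show ?thesis by (intro conjI)
qed

end
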